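(* Let $K\subset\mathcal P_1(\mathbb R)$. Then the following statements are equivalent: (i) The identity is uniformly integrable for $K$, i.e. $\sup_{\mu\in K}\int_{\mathbb R}1_{[-s,s]^c}(x)\,|x|\,d\mu(x)\to0$ as $s\to\infty$. (ii) There exist $\underline\mu,\overline\mu\in\mathcal P_1(\mathbb R)$ with $\underline\mu\leq_{\rm icv}\mu\leq_{\rm icx}\overline\mu$ for all $\mu\in K$. (iii) Every nonempty subset of $K$ has a least upper bound and a greatest lower bound in $\mathcal P_1(\mathbb R)$ with respect to $\leq_{\rm icv}$ and with respect to $\leq_{\rm icx}$. (iv) There exists a nondecreasing function $\psi\colon[0,\infty)\to[0,\infty)$ with $\psi(0)=0$, $\frac{\psi(s)}{s}\to\infty$ as $s\to\infty$ and $$\sup_{\mu\in K}\int_{\mathbb R}\psi(|x|)\,d\mu(x)<\infty.$$ In this case, if $K$ is nonempty, then for the greatest lower bound $\underline\mu=\inf_{\rm icv}K$ of $K$ with respect to $\leq_{\rm icv}$ and the least upper bound $\overline\mu=\sup_{\rm icx}K$ of $K$ with respect to $\leq_{\rm icx}$, $$\int_{\mathbb R}x\,d\underline\mu(x)=\inf_{\mu\in K}\int_{\mathbb R}x\,d\mu(x)\quad\text{and}\quad\int_{\mathbb R}x\,d\overline\mu(x)=\sup_{\mu\in K}\int_{\mathbb R}x\,d\mu(x).$$ Moreover, the function $\psi$ in (iv) can be chosen to be continuously differentiable, strictly convex and uniformly integrable for $K$.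
   Context: $\mathcal P_1(\mathbb R)$ is the set of all Borel probability measures $\mu$ on $\mathbb R$ with $\int_{\mathbb R}|x|\,d\mu(x)<\infty$. For $\mu\in\mathcal P_1(\mathbb R)$ and $s\in\mathbb R$ set $$\mu_{1,-}(s):=\int_{\mathbb R}\min\{x-s,0\}\,d\mu(x)=-\int_{-\infty}^s\mu((-\infty,u])\,du,\qquad \mu_{1,+}(s):=\int_{\mathbb R}\max\{x-s,0\}\,d\mu(x)=\int_s^\infty\mu((u,\infty))\,du .$$ The increasing concave order (second order stochastic dominance) is $\mu\leq_{\rm icv}\nu$ iff $\mu_{1,-}(s)\leq\nu_{1,-}(s)$ for all $s\in\mathbb R$; the increasing convex order is $\mu\leq_{\rm icx}\nu$ iff $\mu_{1,+}(s)\leq\nu_{1,+}(s)$ for all $s\in\mathbb R$. Both are lattice orders on $\mathcal P_1(\mathbb R)$. A nondecreasing function $\psi\colon[0,\infty)\to[0,\infty)$ is uniformly integrable for $K$ if $\sup_{\mu\in K}\int_{\mathbb R}1_{[-s,s]^c}(x)\,\psi(|x|)\,d\mu(x)\to0$ as $s\to\infty$. *)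

theory Defs
  imports "HOL-Probability.Probability" "HOL-Algebra.Order"
begin

definition P1 :: "real measure set" where
  "P1 = {\<mu>. real_distribution \<mu> \<and> integrable \<mu> (\<lambda>x. \<bar>x\<bar>)}"

definition mu1_minus :: "real measure \<Rightarrow> real \<Rightarrow> real" where
  "mu1_minus \<mu> s = (\<integral>x. min (x - s) 0 \<partial>\<mu>)"

definition mu1_plus :: "real measure \<Rightarrow> real \<Rightarrow> real" where
  "mu1_plus \<mu> s = (\<integral>x. max (x - s) 0 \<partial>\<mu>)"

definition icv_le :: "real measure \<Rightarrow> real measure \<Rightarrow> bool" (infix \<open>\<le>icv\<close> 50) where
  "\<mu> \<le>icv \<nu> \<longleftrightarrow> (\<forall>s. mu1_minus \<mu> s \<le> mu1_minus \<nu> s)"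

definition icx_le :: "real measure \<Rightarrow> real measure \<Rightarrow> bool" (infix \<open>\<le>icx\<close> 50) where
  "\<mu> \<le>icx \<nu> \<longleftrightarrow> (\<forall>s. mu1_plus \<mu> s \<le> mu1_plus \<nu> s)"

definition icv_order :: "real measure gorder" where
  "icv_order = \<lparr>carrier = P1, eq = (=), le = icv_le\<rparr>"

definition icx_order :: "real measure gorder" where
  "icx_order = \<lparr>carrier = P1, eq = (=), le = icx_le\<rparr>"

(* Functions from [0,oo) to [0,oo) are encoded as functions real => real of which only the values
   on {0..} are constrained or used. *)

definition nondecreasing_nonneg :: "(real \<Rightarrow> real) \<Rightarrow> bool" where
  "nondecreasing_nonneg \<psi> \<longleftrightarrow> mono_on {0..} \<psi> \<and> (\<forall>s\<ge>0. 0 \<le> \<psi> s)"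

(* The supremum is taken in [0,oo], so it is 0 for empty K and may be infinite for small s. *)
definition uniformly_integrable_for :: "(real \<Rightarrow> real) \<Rightarrow> real measure set \<Rightarrow> bool" where
  "uniformly_integrable_for \<psi> K \<longleftrightarrow>
     ((\<lambda>s. SUP \<mu>\<in>K. \<integral>\<^sup>+x. indicator (- {-s..s}) x * ennreal (\<psi> \<bar>x\<bar>) \<partial>\<mu>) \<longlongrightarrow> 0) at_top"

definition superlinear_moment_bound :: "(real \<Rightarrow> real) \<Rightarrow> real measure set \<Rightarrow> bool" where
  "superlinear_moment_bound \<psi> K \<longleftrightarrow>
     nondecreasing_nonneg \<psi> \<and> \<psi> 0 = 0 \<and> filterlim (\<lambda>s. \<psi> s / s) at_top at_top \<and>
     (SUP \<mu>\<in>K. \<integral>\<^sup>+x. ennreal (\<psi> \<bar>x\<bar>) \<partial>\<mu>) < \<infinity>"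

(* The derivative at 0 is the right derivative. *)
definition continuously_differentiable_nonneg :: "(real \<Rightarrow> real) \<Rightarrow> bool" where
  "continuously_differentiable_nonneg \<psi> \<longleftrightarrow>
     (\<exists>\<psi>'. (\<forall>s\<ge>0. (\<psi> has_real_derivative \<psi>' s) (at s within {0..})) \<and> continuous_on {0..} \<psi>')"

definition strictly_convex_on :: "real set \<Rightarrow> (real \<Rightarrow> real) \<Rightarrow> bool" where
  "strictly_convex_on S f \<longleftrightarrow> convex S \<and>
     (\<forall>x\<in>S. \<forall>y\<in>S. \<forall>t. x \<noteq> y \<longrightarrow> 0 < t \<longrightarrow> t < 1 \<longrightarrow>
        f ((1 - t) * x + t * y) < (1 - t) * f x + t * f y)"

end

theory Submission
  imports Defs "HOL-Real_Asymp.Real_Asymp"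
begin

text \<open>
  Reflection at the origin turns \<open>\<le>icv\<close> into the reverse of \<open>\<le>icx\<close>, so only the latter needs to be
  studied. A convex function \<open>f\<close> which tends to \<open>0\<close> at \<open>\<infinity>\<close>, and for which \<open>s + f s\<close> is
  nondecreasing with a finite limit at \<open>-\<infinity>\<close>, is \<^term>\<open>mu1_plus \<mu>\<close> for a \<open>\<mu>\<close> in \<^term>\<open>P1\<close>. These
  properties pass to pointwise suprema of functions \<^term>\<open>mu1_plus \<mu>\<close> as soon as the supremum
  vanishes at \<open>\<infinity>\<close>, which uniform integrability and an upper bound both guarantee. Conversely,
  \<open>\<bar>x\<bar> \<le> 2 * (max (\<bar>x\<bar> - s / 2) 0)\<close> for \<open>\<bar>x\<bar> > s\<close> bounds the tails by those of the two bounding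
  measures. The function \<open>\<psi>\<close> is a sum of shifted copies of \<open>t\<^sup>2 / (1 + t)\<close>, with shifts chosen so
  that the tail moments beyond them decrease geometrically.
\<close>

section \<open>Integrated tails of measures with finite mean\<close>

lemma P1_prob_space: "\<mu> \<in> P1 \<Longrightarrow> prob_space \<mu>"
  by (simp add: P1_def real_distribution_def)

lemma P1_sets: "\<mu> \<in> P1 \<Longrightarrow> sets \<mu> = sets borel"
  by (simp add: P1_def real_distribution_def real_distribution_axioms_def)

lemma P1_integrable:
  assumes "\<mu> \<in> P1"
  shows "integrable \<mu> (\<lambda>x. x)"
    and "integrable \<mu> (\<lambda>x. max (x - s) 0)"
    and "integrable \<mu> (\<lambda>x. min (x - s) 0)"
proof -
  interpret prob_space \<mu> using assms by (rule P1_prob_space)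
  have [measurable_cong]: "sets \<mu> = sets borel" using assms by (rule P1_sets)
  have "integrable \<mu> (\<lambda>x. \<bar>x\<bar>)" using assms by (simp add: P1_def)
  then show *: "integrable \<mu> (\<lambda>x. x)"
    by (rule Bochner_Integration.integrable_bound) auto
  show "integrable \<mu> (\<lambda>x. max (x - s) 0)" "integrable \<mu> (\<lambda>x. min (x - s) 0)"
    by (intro integrable_max integrable_min Bochner_Integration.integrable_diff * integrable_const)+
qed

lemma mu1_plus_nonneg: "0 \<le> mu1_plus \<mu> s"
  unfolding mu1_plus_def by (rule Bochner_Integration.integral_nonneg) simp

lemma mu1_plus_antimono:
  assumes "\<mu> \<in> P1" "s \<le> t"
  shows "mu1_plus \<mu> t \<le> mu1_plus \<mu> s"
  unfolding mu1_plus_def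
  by (intro integral_mono P1_integrable assms) (use assms in auto)

lemma mu1_minus_mono:
  assumes "\<mu> \<in> P1" "s \<le> t"
  shows "mu1_minus \<mu> t \<le> mu1_minus \<mu> s"
  unfolding mu1_minus_def
  by (intro integral_mono P1_integrable assms) (use assms in auto)

lemma mu1_minus_nonpos: "mu1_minus \<mu> s \<le> 0"
proof -
  have "0 \<le> (\<integral>x. - min (x - s) 0 \<partial>\<mu>)"
    by (rule Bochner_Integration.integral_nonneg) simp
  then show ?thesis by (simp add: mu1_minus_def)
qed

text \<open>Integrates \<open>max (x - s) 0 + min (x - s) 0 = x - s\<close>. Through the mean, every
  bound on one integrated tail becomes a bound on the other.\<close>

lemma mu1_plus_eq:
  assumes "\<mu> \<in> P1"
  shows "mu1_plus \<mu> s = (\<integral>x. x \<partial>\<mu>) - s - mu1_minus \<mu> s"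
proof -
  interpret prob_space \<mu> using assms by (rule P1_prob_space)
  have "mu1_plus \<mu> s + mu1_minus \<mu> s = (\<integral>x. max (x - s) 0 + min (x - s) 0 \<partial>\<mu>)"
    unfolding mu1_plus_def mu1_minus_def
    by (intro Bochner_Integration.integral_add[symmetric] P1_integrable assms)
  also have "\<dots> = (\<integral>x. x - s \<partial>\<mu>)"
    by (intro Bochner_Integration.integral_cong) auto
  also have "\<dots> = (\<integral>x. x \<partial>\<mu>) - s"
    using P1_integrable(1)[OF assms] by (subst Bochner_Integration.integral_diff) (auto simp: prob_space)
  finally show ?thesis by simp
qed

text \<open>For fixed z the hinge \<open>max (z - s) 0\<close> is convex in s, and integration over
  z preserves the inequality.\<close>

lemma convex_on_mu1_plus:
  assumes "\<mu> \<in> P1"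
  shows "convex_on UNIV (mu1_plus \<mu>)"
proof (rule convex_onI)
  fix t x y :: real
  assume t: "0 < t" "t < 1"
  have [intro, simp]: "integrable \<mu> (\<lambda>z. max (z - r) 0)" for r
    by (rule P1_integrable[OF assms])
  have "mu1_plus \<mu> ((1 - t) * x + t * y)
      \<le> (\<integral>z. (1 - t) * max (z - x) 0 + t * max (z - y) 0 \<partial>\<mu>)"
    unfolding mu1_plus_def
  proof (rule integral_mono)
    fix z
    have "(1 - t) * (z - x) \<le> (1 - t) * max (z - x) 0" "t * (z - y) \<le> t * max (z - y) 0"
      "0 \<le> (1 - t) * max (z - x) 0" "0 \<le> t * max (z - y) 0"
      using t by (auto intro!: mult_left_mono)
    moreover have "z - ((1 - t) * x + t * y) = (1 - t) * (z - x) + t * (z - y)"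
      by (simp add: algebra_simps)
    ultimately show "max (z - ((1 - t) * x + t * y)) 0 \<le> (1 - t) * max (z - x) 0 + t * max (z - y) 0"
      by linarith
  qed auto
  also have "\<dots> = (1 - t) * mu1_plus \<mu> x + t * mu1_plus \<mu> y"
    unfolding mu1_plus_def by (subst Bochner_Integration.integral_add) auto
  finally show "mu1_plus \<mu> ((1 - t) *\<^sub>R x + t *\<^sub>R y) \<le> (1 - t) * mu1_plus \<mu> x + t * mu1_plus \<mu> y"
    by simp
qed simp

lemma mu1_plus_tendsto_0:
  assumes "\<mu> \<in> P1"
  shows "(mu1_plus \<mu> \<longlongrightarrow> 0) at_top"
proof -
  have [measurable_cong]: "sets \<mu> = sets borel" using assms by (rule P1_sets)
  have "((\<lambda>s. \<integral>x. max (x - s) 0 \<partial>\<mu>) \<longlongrightarrow> (\<integral>x. 0 \<partial>\<mu>)) at_top"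
  \<comment> \<open>The integrand at s = 0 dominates all later ones; for each fixed x the integrand
    is 0 once s passes x.\<close>
  proof (rule integral_dominated_convergence_at_top[where w = "\<lambda>x. max (x - 0) 0"])
    show "\<forall>\<^sub>F s in at_top. AE x in \<mu>. norm (max (x - s) 0 :: real) \<le> max (x - 0) 0"
      using eventually_ge_at_top[of "0::real"] by eventually_elim auto
    show "AE x in \<mu>. ((\<lambda>s. max (x - s) 0) \<longlongrightarrow> 0) at_top"
    proof (rule AE_I2)
      fix x :: real
      show "((\<lambda>s. max (x - s) 0) \<longlongrightarrow> 0) at_top"
        by (rule tendsto_eventually) (use eventually_ge_at_top[of x] in eventually_elim, auto)
    qed
  qed (use P1_integrable(2)[OF assms, of 0] in auto)
  then show ?thesis by (simp add: mu1_plus_def[abs_def])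
qed

section \<open>Reflection at the origin\<close>

definition reflect :: "real measure \<Rightarrow> real measure" where
  "reflect \<mu> = distr \<mu> borel uminus"

lemma reflect_P1:
  assumes "\<mu> \<in> P1"
  shows "reflect \<mu> \<in> P1"
proof -
  interpret prob_space \<mu> using assms by (rule P1_prob_space)
  have [measurable_cong]: "sets \<mu> = sets borel" using assms by (rule P1_sets)
  have "integrable \<mu> (\<lambda>x. \<bar>x\<bar>)" using assms by (simp add: P1_def)
  then show ?thesis
    unfolding P1_def reflect_def
    by (auto simp: integrable_distr_eq intro!: real_distribution_distr)
qed

lemma reflect_reflect:
  assumes "\<mu> \<in> P1"
  shows "reflect (reflect \<mu>) = \<mu>"
proof -
  have [measurable_cong]: "sets \<mu> = sets borel" using assms by (rule P1_sets)
  have "reflect (reflect \<mu>) = distr \<mu> borel (\<lambda>x. x)"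
    unfolding reflect_def by (subst distr_distr) (auto simp: comp_def)
  also have "\<dots> = \<mu>"
    using distr_id2[of borel \<mu>] P1_sets[OF assms] by (simp add: id_def)
  finally show ?thesis .
qed

lemma integral_reflect:
  assumes "\<mu> \<in> P1" and [measurable]: "f \<in> borel_measurable borel"
  shows "(\<integral>x. f x \<partial>reflect \<mu>) = (\<integral>x. f (- x) \<partial>\<mu> :: real)"
proof -
  have [measurable_cong]: "sets \<mu> = sets borel" using assms(1) by (rule P1_sets)
  show ?thesis unfolding reflect_def by (subst integral_distr) auto
qed

lemma mean_reflect: "\<mu> \<in> P1 \<Longrightarrow> (\<integral>x. x \<partial>reflect \<mu>) = - (\<integral>x. x \<partial>\<mu>)"
  by (subst integral_reflect) auto

lemma mu1_plus_reflect:
  assumes "\<mu> \<in> P1"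
  shows "mu1_plus (reflect \<mu>) s = - mu1_minus \<mu> (- s)"
proof -
  have "mu1_plus (reflect \<mu>) s = (\<integral>x. max (- x - s) 0 \<partial>\<mu>)"
    unfolding mu1_plus_def by (rule integral_reflect) (use assms in auto)
  also have "\<dots> = (\<integral>x. - min (x + s) 0 \<partial>\<mu>)"
    by (intro Bochner_Integration.integral_cong) auto
  finally show ?thesis by (simp add: mu1_minus_def)
qed

text \<open>The minus sign in \<open>mu1_plus_reflect\<close> reverses the inequality; replacing s
  by - s only permutes the thresholds.\<close>

lemma icv_le_iff_reflect:
  assumes "\<mu> \<in> P1" "\<nu> \<in> P1"
  shows "\<mu> \<le>icv \<nu> \<longleftrightarrow> reflect \<nu> \<le>icx reflect \<mu>"
  unfolding icv_le_def icx_le_def mu1_plus_reflect[OF assms(1)] mu1_plus_reflect[OF assms(2)]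
  by simp (metis minus_minus)

section \<open>Limits at minus infinity, comparison of means, Dirac measures\<close>

lemma mu1_minus_tendsto_0:
  assumes "\<mu> \<in> P1"
  shows "(mu1_minus \<mu> \<longlongrightarrow> 0) at_bot"
proof -
  have "((\<lambda>s. - mu1_plus (reflect \<mu>) (- s)) \<longlongrightarrow> - 0) at_bot"
    by (intro tendsto_minus filterlim_compose[OF mu1_plus_tendsto_0[OF reflect_P1[OF assms]]]
        filterlim_uminus_at_top_at_bot)
  then show ?thesis by (simp add: mu1_plus_reflect assms)
qed

lemma mean_le_mu1_plus:
  assumes "\<mu> \<in> P1"
  shows "(\<integral>x. x \<partial>\<mu>) \<le> s + mu1_plus \<mu> s"
  using mu1_plus_eq[OF assms, of s] mu1_minus_nonpos[of \<mu> s] by simp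

text \<open>The mean can thus be read off the integrated tail alone, so a pointwise comparison of
  integrated tails also orders the means.\<close>

lemma tendsto_mean:
  assumes "\<mu> \<in> P1"
  shows "((\<lambda>s. s + mu1_plus \<mu> s) \<longlongrightarrow> (\<integral>x. x \<partial>\<mu>)) at_bot"
proof -
  have "((\<lambda>s. (\<integral>x. x \<partial>\<mu>) - mu1_minus \<mu> s) \<longlongrightarrow> (\<integral>x. x \<partial>\<mu>) - 0) at_bot"
    by (intro tendsto_intros mu1_minus_tendsto_0 assms)
  then show ?thesis by (simp add: mu1_plus_eq assms)
qed

lemma icx_le_mean:
  assumes "\<mu> \<in> P1" "\<nu> \<in> P1" "\<mu> \<le>icx \<nu>"
  shows "(\<integral>x. x \<partial>\<mu>) \<le> (\<integral>x. x \<partial>\<nu>)"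
proof (rule tendsto_le[OF _ tendsto_mean[OF assms(2)] tendsto_mean[OF assms(1)]])
  show "\<forall>\<^sub>F s in at_bot. s + mu1_plus \<mu> s \<le> s + mu1_plus \<nu> s"
    using assms(3) by (simp add: icx_le_def)
qed simp

lemma icv_le_mean:
  assumes "\<mu> \<in> P1" "\<nu> \<in> P1" "\<mu> \<le>icv \<nu>"
  shows "(\<integral>x. x \<partial>\<mu>) \<le> (\<integral>x. x \<partial>\<nu>)"
  using icx_le_mean[of "reflect \<nu>" "reflect \<mu>"] assms
  by (simp add: icv_le_iff_reflect reflect_P1 mean_reflect)

lemma mu1_plus_return: "mu1_plus (return borel m) s = max (m - s) 0"
  unfolding mu1_plus_def by (subst integral_return) auto

lemma return_P1: "return borel m \<in> P1"
  unfolding P1_def real_distribution_def real_distribution_axioms_def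
  by (auto intro!: prob_space_return) 
     (subst integrable_iff_bounded, auto simp: nn_integral_return)

section \<open>Measures with a prescribed integrated tail\<close>

text \<open>If \<open>f = mu1_plus \<mu>\<close>, then the right derivative of \<open>f\<close> at \<open>s\<close> is \<open>- \<mu> {s<..}\<close>; for convex
  \<open>f\<close> it is the infimum of the difference quotients to the right.\<close>

definition cdf_of :: "(real \<Rightarrow> real) \<Rightarrow> real \<Rightarrow> real" where
  "cdf_of f s = 1 + (INF t\<in>{s<..}. (f t - f s) / (t - s))"

text \<open>\<open>antimono\<close> and \<open>mono_add\<close> keep all slopes in [-1, 0], so
  \<open>cdf_of f\<close> has values in [0, 1]. \<open>lim_top\<close> fixes the additive constant
  of \<open>f\<close>; the finite limit \<open>c\<close>, which becomes the mean of the constructed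
  measure, makes the negative part integrable.\<close>

locale mu1_plus_like =
  fixes f :: "real \<Rightarrow> real" and c :: real
  assumes convex: "convex_on UNIV f"
    and antimono: "s \<le> t \<Longrightarrow> f t \<le> f s"
    and mono_add: "s \<le> t \<Longrightarrow> s + f s \<le> t + f t"
    and lim_top: "(f \<longlongrightarrow> 0) at_top"
    and lim_bot: "((\<lambda>s. s + f s) \<longlongrightarrow> c) at_bot"
begin

lemma slope_ge: "s < t \<Longrightarrow> -1 \<le> (f t - f s) / (t - s)"
  using mono_add[of s t] by (simp add: le_divide_eq)

lemma bdd_below_slopes: "bdd_below ((\<lambda>t. (f t - f s) / (t - s)) ` {s<..})"
  by (rule bdd_belowI2[where m = "-1"]) (simp add: slope_ge)

lemma cdf_of_le_slope: "s < t \<Longrightarrow> cdf_of f s - 1 \<le> (f t - f s) / (t - s)"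
  unfolding cdf_of_def using bdd_below_slopes by (auto intro: cINF_lower)

text \<open>Chords of a convex function get steeper to the right: the chord ending at t is at most
  as steep as every chord starting at t, hence bounded by their infimum.\<close>

lemma slope_le_cdf_of:
  assumes "s < t"
  shows "(f t - f s) / (t - s) \<le> cdf_of f t - 1"
proof -
  have "(f t - f s) / (t - s) \<le> (INF u\<in>{t<..}. (f u - f t) / (u - t))"
  proof (rule cINF_greatest)
    fix u assume "u \<in> {t<..}"
    then have u: "t < u" by simp
    have "(f s - f t) / (s - t) \<le> (f t - f u) / (t - u)"
      using convex_on_slope_le[OF convex, of s u t] assms u by simp
    also have "(f s - f t) / (s - t) = (f t - f s) / (t - s)"
      using assms by (simp add: field_simps)
    also have "(f t - f u) / (t - u) = (f u - f t) / (u - t)"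
      using u by (simp add: field_simps)
    finally show "(f t - f s) / (t - s) \<le> (f u - f t) / (u - t)" .
  qed simp
  then show ?thesis by (simp add: cdf_of_def)
qed

text \<open>The slope of the chord over [s, t] separates the two values.\<close>

lemma cdf_of_mono: "s \<le> t \<Longrightarrow> cdf_of f s \<le> cdf_of f t"
  using cdf_of_le_slope[of s t] slope_le_cdf_of[of s t] by (cases "s = t") auto

lemma cdf_of_bounds: "0 \<le> cdf_of f s" "cdf_of f s \<le> 1"
proof -
  show "0 \<le> cdf_of f s"
    using slope_le_cdf_of[of "s - 1" s] slope_ge[of "s - 1" s] by simp
  show "cdf_of f s \<le> 1"
    using cdf_of_le_slope[of s "s + 1"] antimono[of s "s + 1"] by simp
qed

lemma cdf_of_tendsto_0: "(cdf_of f \<longlongrightarrow> 0) at_bot"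
proof (rule tendsto_sandwich[where f = "\<lambda>_. 0" and h = "\<lambda>s. 1 + f (s + 1) - f s"])
  \<comment> \<open>The chord of length 1 to the right of s bounds \<open>cdf_of f s\<close>; one
    plus its slope is an increment of \<open>s + f s\<close>, which converges to
    \<open>c\<close>.\<close>
  have "((\<lambda>s. ((s + 1) + f (s + 1)) - (s + f s)) \<longlongrightarrow> c - c) at_bot"
    by (intro tendsto_diff lim_bot filterlim_compose[OF lim_bot])
       (subst add.commute, simp add: filterlim_tendsto_add_at_bot_iff[OF tendsto_const] filterlim_ident)
  then show "((\<lambda>s. 1 + f (s + 1) - f s) \<longlongrightarrow> 0) at_bot"
    by (simp add: algebra_simps)
  show "\<forall>\<^sub>F s in at_bot. cdf_of f s \<le> 1 + f (s + 1) - f s"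
    using cdf_of_le_slope[of s "s + 1" for s] by (simp add: algebra_simps)
qed (auto simp: cdf_of_bounds)

lemma cdf_of_tendsto_1: "(cdf_of f \<longlongrightarrow> 1) at_top"
proof (rule tendsto_sandwich)
  have "((\<lambda>s. 1 + (f s - f (- 1 + s))) \<longlongrightarrow> 1 + (0 - 0)) at_top"
    by (intro tendsto_intros lim_top filterlim_compose[OF lim_top]
        filterlim_tendsto_add_at_top[OF tendsto_const] filterlim_ident)
  then show "((\<lambda>s. 1 + f s - f (s - 1)) \<longlongrightarrow> 1) at_top"
    by (simp add: algebra_simps)
  show "\<forall>\<^sub>F s in at_top. 1 + f s - f (s - 1) \<le> cdf_of f s"
    using slope_le_cdf_of[of "s - 1" s for s] by (simp add: algebra_simps)
qed (auto simp: cdf_of_bounds)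

lemma isCont_f: "isCont f s"
  using convex_on_continuous[OF open_UNIV convex] by (simp add: continuous_on_eq_continuous_at)

text \<open>The lower half is monotonicity. For the upper half, fix a chord from s to t whose slope
  is already below the target; continuity of \<open>f\<close> lets its left end move slightly to the
  right, and the moved chord still bounds \<open>cdf_of f\<close> there.\<close>

lemma cdf_of_right_continuous: "continuous (at_right s) (cdf_of f)"
  unfolding continuous_within
proof (rule order_tendstoI)
  fix a assume "a < cdf_of f s"
  moreover have "\<forall>\<^sub>F t in at_right s. s < t" by (simp add: eventually_at_right_less)
  ultimately show "\<forall>\<^sub>F t in at_right s. a < cdf_of f t"
    by (auto elim!: eventually_mono intro: less_le_trans[OF _ cdf_of_mono])
next
  fix a assume "cdf_of f s < a"
  then have "(INF t\<in>{s<..}. (f t - f s) / (t - s)) < a - 1"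
    by (simp add: cdf_of_def)
  then obtain t where t: "s < t" "(f t - f s) / (t - s) < a - 1"
    using bdd_below_slopes[of s] by (subst (asm) cINF_less_iff) auto
  have "((\<lambda>r. (f t - f r) / (t - r)) \<longlongrightarrow> (f t - f s) / (t - s)) (at_right s)"
    using t(1) isCont_f[of s]
    by (intro tendsto_intros) (auto simp: isCont_def intro: tendsto_within_subset)
  then have "\<forall>\<^sub>F r in at_right s. (f t - f r) / (t - r) < a - 1"
    using t(2) by (rule order_tendstoD)
  moreover have "\<forall>\<^sub>F r in at_right s. r < t" 
    using t(1) by (auto simp: eventually_at_right_field)
  ultimately show "\<forall>\<^sub>F r in at_right s. cdf_of f r < a"
  proof eventually_elim
    case (elim r)
    then show ?case using cdf_of_le_slope[of r t] by simp
  qed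
qed

section \<open>The measure with distribution function \<open>cdf_of f\<close> and its integrated
  tail\<close>

definition law :: "real measure" where
  "law = interval_measure (cdf_of f)"

lemma real_distribution_law: "real_distribution law"
  unfolding law_def
  by (intro real_distribution_interval_measure cdf_of_mono cdf_of_right_continuous
      cdf_of_tendsto_0 cdf_of_tendsto_1)

lemma cdf_law: "cdf law = cdf_of f"
  unfolding law_def
  by (intro cdf_interval_measure cdf_of_mono cdf_of_right_continuous cdf_of_tendsto_0)

lemma integrable_clamp: "integrable law (\<lambda>x. min (max x a) b)"
proof -
  interpret real_distribution law by (rule real_distribution_law)
  show ?thesis
    by (rule integrable_const_bound[where B = "\<bar>a\<bar> + \<bar>b\<bar>"]) auto
qed

text \<open>This is the integral of the tail probability \<open>law {u<..}\<close> over u in [a, b],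
  written with a bounded integrand so that it is finite before any moment of \<open>law\<close> is
  known to be.\<close>

definition clamp_mean :: "real \<Rightarrow> real \<Rightarrow> real" where
  "clamp_mean a b = (\<integral>x. min (max x a) b \<partial>law) - a"

lemma clamp_mean_add:
  assumes "a \<le> b" "b \<le> d"
  shows "clamp_mean a d = clamp_mean a b + clamp_mean b d"
proof -
  interpret real_distribution law by (rule real_distribution_law)
  have "(\<integral>x. min (max x a) b \<partial>law) + (\<integral>x. min (max x b) d \<partial>law)
      = (\<integral>x. min (max x a) b + min (max x b) d \<partial>law)"
    by (intro Bochner_Integration.integral_add[symmetric] integrable_clamp)
  \<comment> \<open>Of the two clamped values at least one equals \<open>b\<close>; the other is x
    clamped to the whole interval [a, d].\<close>
  also have "\<dots> = (\<integral>x. b + min (max x a) d \<partial>law)"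
    by (intro Bochner_Integration.integral_cong) (use assms in auto)
  also have "\<dots> = b + (\<integral>x. min (max x a) d \<partial>law)"
    by (subst Bochner_Integration.integral_add) (auto simp: integrable_clamp prob_space[simplified])
  finally show ?thesis by (simp add: clamp_mean_def)
qed

lemma prob_greaterThan: "prob_space.prob law {a<..} = 1 - cdf_of f a"
proof -
  interpret real_distribution law by (rule real_distribution_law)
  have "prob {a<..} = prob (space law - {..a})"
    by (rule arg_cong[where f = prob]) auto
  also have "\<dots> = 1 - cdf law a"
    by (subst prob_compl) (auto simp: cdf_def)
  finally show ?thesis by (simp add: cdf_law)
qed

text \<open>The clamped value minus \<open>a\<close> lies between \<open>b - a\<close> times the
  indicators of \<open>{b<..}\<close> and of \<open>{a<..}\<close>.\<close>

lemma clamp_mean_bounds: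
  assumes "a \<le> b"
  shows "(b - a) * (1 - cdf_of f b) \<le> clamp_mean a b" "clamp_mean a b \<le> (b - a) * (1 - cdf_of f a)"
proof -
  interpret real_distribution law by (rule real_distribution_law)
  have clamp: "clamp_mean a b = (\<integral>x. min (max x a) b - a \<partial>law)"
    unfolding clamp_mean_def
    by (subst Bochner_Integration.integral_diff) (auto simp: integrable_clamp prob_space[simplified])
  have int: "(b - a) * (1 - cdf_of f u) = (\<integral>x. (b - a) * indicator {u<..} x \<partial>law)" for u
    using prob_greaterThan[of u] by simp
  show "(b - a) * (1 - cdf_of f b) \<le> clamp_mean a b"
    unfolding int clamp
    by (intro integral_mono Bochner_Integration.integrable_diff integrable_clamp)
       (use assms in \<open>auto split: split_indicator simp: emeasure_eq_measure intro!: integrable_real_indicator\<close>)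
  show "clamp_mean a b \<le> (b - a) * (1 - cdf_of f a)"
    unfolding int clamp
    by (intro integral_mono Bochner_Integration.integrable_diff integrable_clamp)
       (use assms in \<open>auto split: split_indicator simp: emeasure_eq_measure intro!: integrable_real_indicator\<close>)
qed

text \<open>The chord slope lies between \<open>cdf_of f a - 1\<close> and
  \<open>cdf_of f b - 1\<close>, which gives for \<open>f a - f b\<close> the very bounds known for
  \<open>clamp_mean a b\<close>.\<close>

lemma f_diff_bounds:
  assumes "a \<le> b"
  shows "(b - a) * (1 - cdf_of f b) \<le> f a - f b" "f a - f b \<le> (b - a) * (1 - cdf_of f a)"
  using assms cdf_of_le_slope[of a b] slope_le_cdf_of[of a b]
  by (cases "a = b"; simp add: field_simps)+

text \<open>Both sides obey the same bounds on an interval; on a partition into \<open>n\<close> equal pieces these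
  bounds leave a total error of at most \<open>(b - a) / n\<close>, because \<^term>\<open>cdf_of f\<close> is monotone.\<close>

lemma clamp_mean_eq:
  assumes "a \<le> b"
  shows "clamp_mean a b = f a - f b"
proof -
  define D where "D u v = clamp_mean u v - (f u - f v)" for u v
  have D: "\<bar>D u v\<bar> \<le> (v - u) * (cdf_of f v - cdf_of f u)" if "u \<le> v" for u v
    using clamp_mean_bounds[OF that] f_diff_bounds[OF that]
    by (simp add: D_def algebra_simps)
  have bound: "\<bar>D a b\<bar> \<le> (b - a) / real n" if n: "0 < n" for n :: nat
  proof -
    define h where "h = (b - a) / real n"
    have h: "0 \<le> h" "real n * h = b - a" using assms n by (auto simp: h_def)
    define x where "x i = a + real i * h" for i :: nat
    have x_le: "x i \<le> x (Suc i)" and x_diff: "x (Suc i) - x i = h" for i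
      using h(1) by (auto simp: x_def algebra_simps)
    have "D a (x m) = (\<Sum>i<m. D (x i) (x (Suc i)))" for m
    proof (induction m)
      case 0
      then show ?case using D[of a a] by (simp add: x_def)
    next
      case (Suc m)
      have "D a (x (Suc m)) = D a (x m) + D (x m) (x (Suc m))"
        using clamp_mean_add[of a "x m" "x (Suc m)"] x_le h(1)
        by (simp add: D_def) (simp add: x_def)
      then show ?case by (simp add: Suc)
    qed
    from this[of n] have "\<bar>D a b\<bar> \<le> (\<Sum>i<n. \<bar>D (x i) (x (Suc i))\<bar>)"
      using h(2) by (simp add: x_def sum_abs)
    also have "\<dots> \<le> (\<Sum>i<n. h * (cdf_of f (x (Suc i)) - cdf_of f (x i)))"
      by (intro sum_mono) (metis D x_le x_diff)
    also have "\<dots> = h * (cdf_of f (x n) - cdf_of f (x 0))"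
      using sum_lessThan_telescope[of "\<lambda>i. cdf_of f (x i)" n]
      by (simp add: sum_distrib_left[symmetric])
    also have "\<dots> \<le> h * 1"
      using cdf_of_bounds[of "x n"] cdf_of_bounds[of "x 0"] h(1) by (intro mult_left_mono) auto
    finally show ?thesis by (simp add: h_def)
  qed
  have "\<bar>D a b\<bar> \<le> 0"
  proof (rule tendsto_lowerbound)
    show "(\<lambda>n. (b - a) / real n) \<longlonglongrightarrow> 0" by (rule lim_const_over_n)
    show "\<forall>\<^sub>F n in sequentially. \<bar>D a b\<bar> \<le> (b - a) / real n"
      using eventually_gt_at_top[of "0::nat"] by eventually_elim (rule bound)
  qed simp
  then show ?thesis by (simp add: D_def)
qed

text \<open>Truncation at height n turns the integral into
  \<open>clamp_mean a (a + n) = f a - f (a + n)\<close>. Monotone convergence together with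
  \<open>lim_top\<close> removes the truncation.\<close>

lemma has_bochner_integral_plus: "has_bochner_integral law (\<lambda>x. max (x - a) 0) (f a)"
proof -
  interpret real_distribution law by (rule real_distribution_law)
  have "(\<lambda>n. f a - f (a + real n)) \<longlonglongrightarrow> f a - 0"
    by (intro tendsto_intros filterlim_compose[OF lim_top]
        filterlim_tendsto_add_at_top[OF tendsto_const] filterlim_real_sequentially)
  moreover have "(\<integral>x. min (max (x - a) 0) (real n) \<partial>law) = f a - f (a + real n)" for n
  proof -
    have "(\<integral>x. min (max (x - a) 0) (real n) \<partial>law) = (\<integral>x. min (max x a) (a + real n) - a \<partial>law)"
      by (intro Bochner_Integration.integral_cong) auto
    also have "\<dots> = clamp_mean a (a + real n)"
      unfolding clamp_mean_def
      by (subst Bochner_Integration.integral_diff) (auto simp: integrable_clamp prob_space[simplified])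
    finally show ?thesis by (simp add: clamp_mean_eq)
  qed
  ultimately have lim: "(\<lambda>n. \<integral>x. min (max (x - a) 0) (real n) \<partial>law) \<longlonglongrightarrow> f a" by simp
  show ?thesis
  proof (rule has_bochner_integral_monotone_convergence[OF _ _ _ lim])
    show "integrable law (\<lambda>x. min (max (x - a) 0) (real n))" for n
      by (rule integrable_const_bound[where B = "real n"]) auto
    show "AE x in law. mono (\<lambda>n. min (max (x - a) 0) (real n))"
      by (auto simp: mono_def)
    show "AE x in law. (\<lambda>n. min (max (x - a) 0) (real n)) \<longlonglongrightarrow> max (x - a) 0"
    proof (rule AE_I2, rule tendsto_eventually)
      fix x :: real
      show "\<forall>\<^sub>F n in sequentially. min (max (x - a) 0) (real n) = max (x - a) 0"
        using eventually_ge_at_top[of "nat \<lceil>max (x - a) 0\<rceil>"]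
        by eventually_elim (simp add: nat_le_iff ceiling_le_iff)
    qed
  qed auto
qed

lemma mu1_plus_law: "mu1_plus law = f"
  unfolding mu1_plus_def fun_eq_iff
  using has_bochner_integral_plus by (simp add: has_bochner_integral_iff)

text \<open>The same truncation on the left half-line: the truncated integrals increase to the
  finite value \<open>f 0 - c\<close> by \<open>lim_bot\<close>.\<close>

lemma integrable_minus: "integrable law (\<lambda>x. max (- x) 0)"
proof -
  interpret real_distribution law by (rule real_distribution_law)
  have "((\<lambda>s. - (s + f s)) \<longlongrightarrow> - c) at_bot"
    by (intro tendsto_intros lim_bot)
  then have "(\<lambda>n. f 0 - (- real n + f (- real n))) \<longlonglongrightarrow> f 0 - c"
    by (intro tendsto_intros filterlim_compose[OF lim_bot])
       (simp add: filterlim_uminus_at_bot filterlim_real_sequentially)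
  moreover have "(\<integral>x. min (max (- x) 0) (real n) \<partial>law) = f 0 - (- real n + f (- real n))" for n
  proof -
    have "(\<integral>x. min (max (- x) 0) (real n) \<partial>law) = (\<integral>x. - min (max x (- real n)) 0 \<partial>law)"
      by (intro Bochner_Integration.integral_cong) auto
    also have "\<dots> = - clamp_mean (- real n) 0 + real n"
      by (simp add: clamp_mean_def)
    finally show ?thesis by (simp add: clamp_mean_eq)
  qed
  ultimately have lim: "(\<lambda>n. \<integral>x. min (max (- x) 0) (real n) \<partial>law) \<longlonglongrightarrow> f 0 - c" by simp
  show ?thesis
  proof (rule integrable_monotone_convergence[OF _ _ _ lim])
    show "integrable law (\<lambda>x. min (max (- x) 0) (real n))" for n
      by (rule integrable_const_bound[where B = "real n"]) auto
    show "AE x in law. mono (\<lambda>n. min (max (- x) 0) (real n))"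
      by (auto simp: mono_def)
    show "AE x in law. (\<lambda>n. min (max (- x) 0) (real n)) \<longlonglongrightarrow> max (- x) 0"
    proof (rule AE_I2, rule tendsto_eventually)
      fix x :: real
      show "\<forall>\<^sub>F n in sequentially. min (max (- x) 0) (real n) = max (- x) 0"
        using eventually_ge_at_top[of "nat \<lceil>max (- x) 0\<rceil>"]
        by eventually_elim (simp add: nat_le_iff ceiling_le_iff)
    qed
  qed auto
qed

lemma law_P1: "law \<in> P1"
proof -
  have "integrable law (\<lambda>x. max (x - 0) 0 + max (- x) 0)"
    using has_bochner_integral_plus[of 0] integrable_minus
    by (intro Bochner_Integration.integrable_add) (auto simp: has_bochner_integral_iff)
  also have "(\<lambda>x. max (x - 0) 0 + max (- x) 0) = (\<lambda>x::real. \<bar>x\<bar>)"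
    by (auto simp: fun_eq_iff)
  finally show ?thesis
    using real_distribution_law by (simp add: P1_def)
qed

end

section \<open>Lattice bounds\<close>

lemma mono_bounded_below_tendsto_at_bot:
  fixes h :: "real \<Rightarrow> real"
  assumes "mono h" and "\<And>s. m \<le> h s"
  shows "\<exists>c. (h \<longlongrightarrow> c) at_bot"
proof -
  have bdd: "bdd_below (range h)" by (rule bdd_belowI2) (rule assms(2))
  have "(h \<longlongrightarrow> (INF s. h s)) at_bot"
  proof (rule order_tendstoI)
    fix a assume "a < (INF s. h s)"
    then show "\<forall>\<^sub>F s in at_bot. a < h s"
      by (auto intro!: always_eventually intro: less_le_trans cINF_lower[OF bdd])
  next
    fix a assume "(INF s. h s) < a"
    then obtain s0 where "h s0 < a" using bdd by (subst (asm) cINF_less_iff) auto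
    then have "h s < a" if "s \<le> s0" for s
      using monoD[OF assms(1) that] by simp
    then show "\<forall>\<^sub>F s in at_bot. h s < a"
      by (auto simp: eventually_at_bot_linorder)
  qed
  then show ?thesis ..
qed

text \<open>Convexity and both monotonicity properties survive suprema, and \<open>vanish\<close> is
  exactly the limit at infinity. The mean of one fixed member bounds \<open>s + f s\<close> from
  below, so the limit at minus infinity exists.\<close>

lemma SUP_mu1_plus_attained:
  assumes L: "L \<subseteq> P1" "L \<noteq> {}"
    and vanish: "\<And>e. 0 < e \<Longrightarrow> \<exists>s. \<forall>\<mu>\<in>L. mu1_plus \<mu> s \<le> e"
  obtains \<nu> where "\<nu> \<in> P1" "\<And>s. mu1_plus \<nu> s = (SUP \<mu>\<in>L. mu1_plus \<mu> s)"
    "\<And>\<mu>. \<mu> \<in> L \<Longrightarrow> \<mu> \<le>icx \<nu>"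
proof -
  define f where "f s = (SUP \<mu>\<in>L. mu1_plus \<mu> s)" for s
  obtain \<mu>0 where \<mu>0: "\<mu>0 \<in> L" using L(2) by auto
  \<comment> \<open>Both sides are the mean minus a value of \<open>mu1_minus \<mu>\<close>, which
    is nonincreasing.\<close>
  have step: "s + mu1_plus \<mu> s \<le> t + mu1_plus \<mu> t" if "\<mu> \<in> L" "s \<le> t" for \<mu> s t
    using mu1_plus_eq[of \<mu> s] mu1_plus_eq[of \<mu> t] mu1_minus_mono[of \<mu> s t] that L(1) by auto
  \<comment> \<open>A uniform bound at the single point \<open>s0\<close> spreads to all s, because
    every \<open>mu1_plus \<mu>\<close> is nonincreasing with slopes at least -1. This makes the
    real-valued supremum meaningful.\<close>
  obtain s0 where s0: "\<forall>\<mu>\<in>L. mu1_plus \<mu> s0 \<le> 1" using vanish[of 1] by auto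
  have bdd: "bdd_above ((\<lambda>\<mu>. mu1_plus \<mu> s) ` L)" for s
  proof (rule bdd_aboveI2)
    fix \<mu> assume \<mu>: "\<mu> \<in> L"
    show "mu1_plus \<mu> s \<le> 1 + \<bar>s0 - s\<bar>"
      using s0 \<mu> step[OF \<mu>, of s s0] mu1_plus_antimono[of \<mu> s0 s] L(1)
      by (cases "s \<le> s0") force+
  qed
  have le_f: "mu1_plus \<mu> s \<le> f s" if "\<mu> \<in> L" for \<mu> s
    unfolding f_def using that bdd by (rule cSUP_upper)
  have f_le: "f s \<le> r" if "\<And>\<mu>. \<mu> \<in> L \<Longrightarrow> mu1_plus \<mu> s \<le> r" for s r
    unfolding f_def using L(2) that by (rule cSUP_least)
  have convex: "convex_on UNIV f"
  proof (rule convex_onI)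
    fix t x y :: real assume t: "0 < t" "t < 1"
    show "f ((1 - t) *\<^sub>R x + t *\<^sub>R y) \<le> (1 - t) * f x + t * f y"
    proof (rule f_le)
      fix \<mu> assume \<mu>: "\<mu> \<in> L"
      have "mu1_plus \<mu> ((1 - t) *\<^sub>R x + t *\<^sub>R y) \<le> (1 - t) * mu1_plus \<mu> x + t * mu1_plus \<mu> y"
        using convex_on_mu1_plus[of \<mu>] \<mu> L(1) t by (intro convex_onD) auto
      also have "\<dots> \<le> (1 - t) * f x + t * f y"
        using t by (intro add_mono mult_left_mono le_f \<mu>) auto
      finally show "mu1_plus \<mu> ((1 - t) *\<^sub>R x + t *\<^sub>R y) \<le> (1 - t) * f x + t * f y" .
    qed
  qed simp
  have antimono: "f t \<le> f s" if "s \<le> t" for s t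
    using mu1_plus_antimono that L(1) by (intro f_le) (meson le_f order_trans subsetD)
  have mono: "s + f s \<le> t + f t" if st: "s \<le> t" for s t
  proof -
    have "f s \<le> t + f t - s"
    proof (rule f_le)
      fix \<mu> assume \<mu>: "\<mu> \<in> L"
      show "mu1_plus \<mu> s \<le> t + f t - s" using step[OF \<mu> st] le_f[OF \<mu>, of t] by simp
    qed
    then show ?thesis by simp
  qed
  have top: "(f \<longlongrightarrow> 0) at_top"
  proof (rule order_tendstoI)
    fix a :: real assume "a < 0"
    then show "\<forall>\<^sub>F s in at_top. a < f s"
      using le_f[OF \<mu>0] mu1_plus_nonneg[of \<mu>0]
      by (intro always_eventually allI) (meson less_le_trans order_trans)
  next
    fix a :: real assume a: "0 < a"
    obtain s1 where s1: "\<forall>\<mu>\<in>L. mu1_plus \<mu> s1 \<le> a / 2" using vanish[of "a / 2"] a by auto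
    have "f s < a" if "s1 \<le> s" for s
      using antimono[OF that] f_le[of s1 "a / 2"] s1 a by fastforce
    then show "\<forall>\<^sub>F s in at_top. f s < a"
      by (auto simp: eventually_at_top_linorder)
  qed
  have "(\<integral>x. x \<partial>\<mu>0) \<le> s + f s" for s
    using mean_le_mu1_plus[of \<mu>0 s] le_f[OF \<mu>0, of s] \<mu>0 L(1) by auto
  moreover have "mono (\<lambda>s. s + f s)" using mono by (simp add: monoI)
  ultimately obtain c where c: "((\<lambda>s. s + f s) \<longlongrightarrow> c) at_bot"
    using mono_bounded_below_tendsto_at_bot by blast
  interpret mu1_plus_like f c
    by unfold_locales (fact convex antimono mono top c)+
  show thesis
    by (rule that[of law]) (simp_all add: law_P1 mu1_plus_law icx_le_def le_f, simp add: f_def)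
qed

section \<open>Least upper and greatest lower bounds for \<open>\<le>icx\<close>\<close>

lemma is_lub_icx_iff:
  "A \<subseteq> P1 \<Longrightarrow> is_lub icx_order \<nu> A \<longleftrightarrow>
    \<nu> \<in> P1 \<and> (\<forall>\<mu>\<in>A. \<mu> \<le>icx \<nu>) \<and> (\<forall>\<rho>\<in>P1. (\<forall>\<mu>\<in>A. \<mu> \<le>icx \<rho>) \<longrightarrow> \<nu> \<le>icx \<rho>)"
  by (auto simp: least_def Upper_def icx_order_def Int_absorb2)

lemma is_glb_icx_iff:
  "A \<subseteq> P1 \<Longrightarrow> is_glb icx_order \<nu> A \<longleftrightarrow>
    \<nu> \<in> P1 \<and> (\<forall>\<mu>\<in>A. \<nu> \<le>icx \<mu>) \<and> (\<forall>\<rho>\<in>P1. (\<forall>\<mu>\<in>A. \<rho> \<le>icx \<mu>) \<longrightarrow> \<rho> \<le>icx \<nu>)"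
  by (auto simp: greatest_def Lower_def icx_order_def Int_absorb2)

lemma is_lub_icv_iff:
  "A \<subseteq> P1 \<Longrightarrow> is_lub icv_order \<nu> A \<longleftrightarrow>
    \<nu> \<in> P1 \<and> (\<forall>\<mu>\<in>A. \<mu> \<le>icv \<nu>) \<and> (\<forall>\<rho>\<in>P1. (\<forall>\<mu>\<in>A. \<mu> \<le>icv \<rho>) \<longrightarrow> \<nu> \<le>icv \<rho>)"
  by (auto simp: least_def Upper_def icv_order_def Int_absorb2)

lemma is_glb_icv_iff:
  "A \<subseteq> P1 \<Longrightarrow> is_glb icv_order \<nu> A \<longleftrightarrow>
    \<nu> \<in> P1 \<and> (\<forall>\<mu>\<in>A. \<nu> \<le>icv \<mu>) \<and> (\<forall>\<rho>\<in>P1. (\<forall>\<mu>\<in>A. \<rho> \<le>icv \<mu>) \<longrightarrow> \<rho> \<le>icv \<nu>)"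
  by (auto simp: greatest_def Lower_def icv_order_def Int_absorb2)

text \<open>The integrated tail of \<open>u\<close> dominates the whole family and vanishes at
  infinity, so the pointwise supremum is again an integrated tail. As the order is pointwise, that
  measure lies below every upper bound.\<close>

lemma icx_lub_exists:
  assumes A: "A \<subseteq> P1" "A \<noteq> {}" and u: "u \<in> P1" "\<And>\<mu>. \<mu> \<in> A \<Longrightarrow> \<mu> \<le>icx u"
  obtains \<nu> where "is_lub icx_order \<nu> A" "\<And>s. mu1_plus \<nu> s = (SUP \<mu>\<in>A. mu1_plus \<mu> s)"
proof -
  have le: "mu1_plus \<mu> s \<le> mu1_plus u s" if "\<mu> \<in> A" for \<mu> s
    using u(2)[OF that] by (simp add: icx_le_def)
  have "\<exists>s. \<forall>\<mu>\<in>A. mu1_plus \<mu> s \<le> e" if e: "0 < e" for e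
  proof -
    have "\<forall>\<^sub>F s in at_top. mu1_plus u s < e"
      using mu1_plus_tendsto_0[OF u(1)] e by (rule order_tendstoD)
    then obtain s where "mu1_plus u s < e" by (auto simp: eventually_at_top_linorder)
    then show ?thesis using le by (meson less_imp_le order_trans)
  qed
  from SUP_mu1_plus_attained[OF A this] obtain \<nu>
    where \<nu>: "\<nu> \<in> P1" "\<And>s. mu1_plus \<nu> s = (SUP \<mu>\<in>A. mu1_plus \<mu> s)"
      "\<And>\<mu>. \<mu> \<in> A \<Longrightarrow> \<mu> \<le>icx \<nu>" by metis
  have "\<nu> \<le>icx \<rho>" if "\<forall>\<mu>\<in>A. \<mu> \<le>icx \<rho>" for \<rho>
    using that A(2) by (auto simp: icx_le_def \<nu>(2) intro!: cSUP_least)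
  then have "is_lub icx_order \<nu> A"
    unfolding is_lub_icx_iff[OF A(1)] using \<nu>(1,3) by blast
  then show thesis using \<nu>(2) by (rule that)
qed

text \<open>The greatest lower bound is the least upper bound of all lower bounds; the Dirac measure at
  \<open>m\<close> is one of them by Jensen's inequality.\<close>

lemma icx_glb_exists:
  assumes A: "A \<subseteq> P1" "A \<noteq> {}" and m: "\<And>\<mu>. \<mu> \<in> A \<Longrightarrow> m \<le> (\<integral>x. x \<partial>\<mu>)"
  shows "\<exists>\<nu>. is_glb icx_order \<nu> A"
proof -
  define L where "L = {\<rho>\<in>P1. \<forall>\<mu>\<in>A. \<rho> \<le>icx \<mu>}"
  obtain \<mu>0 where \<mu>0: "\<mu>0 \<in> A" using A(2) by auto
  have L: "L \<subseteq> P1" by (auto simp: L_def)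
  have "return borel m \<in> L"
    unfolding L_def icx_le_def
  proof (intro CollectI conjI return_P1 ballI allI)
    fix \<mu> s assume \<mu>: "\<mu> \<in> A"
    with A(1) have "(\<integral>x. x \<partial>\<mu>) \<le> s + mu1_plus \<mu> s" by (auto intro: mean_le_mu1_plus)
    with m[OF \<mu>] mu1_plus_nonneg[of \<mu> s] show "mu1_plus (return borel m) s \<le> mu1_plus \<mu> s"
      by (simp add: mu1_plus_return)
  qed
  then have ne: "L \<noteq> {}" by auto
  \<comment> \<open>Any member of \<open>A\<close> is an upper bound of \<open>L\<close>, as
    \<open>icx_lub_exists\<close> requires.\<close>
  obtain \<nu> where "is_lub icx_order \<nu> L"
    by (rule icx_lub_exists[OF L ne, of \<mu>0]) (use A(1) \<mu>0 in \<open>auto simp: L_def\<close>)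
  \<comment> \<open>Every member of \<open>A\<close> bounds \<open>L\<close> from above, so the
    least such bound lies below it and is itself a lower bound of \<open>A\<close>.\<close>
  then have "is_glb icx_order \<nu> A"
    unfolding is_lub_icx_iff[OF L] is_glb_icx_iff[OF A(1)] using A(1) by (auto simp: L_def)
  then show ?thesis ..
qed

section \<open>Transfer to \<open>\<le>icv\<close> by reflection, and existence of all
  bounds\<close>

lemma ball_P1_reflect: "(\<forall>\<rho>\<in>P1. Q (reflect \<rho>)) \<longleftrightarrow> (\<forall>\<rho>\<in>P1. Q \<rho>)"
  by (metis reflect_P1 reflect_reflect)

lemma is_lub_icv_reflect:
  assumes A: "A \<subseteq> P1" and "\<nu> \<in> P1"
  shows "is_lub icv_order \<nu> A \<longleftrightarrow> is_glb icx_order (reflect \<nu>) (reflect ` A)"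
proof -
  have A': "reflect ` A \<subseteq> P1" using A reflect_P1 by auto
  show ?thesis
    unfolding is_lub_icv_iff[OF A] is_glb_icx_iff[OF A']
    using assms
    \<comment> \<open>As \<open>reflect\<close> is an involution of \<open>P1\<close>, the competing
      bounds may be taken to be reflected measures.\<close>
    by (subst ball_P1_reflect[symmetric]) (auto simp: icv_le_iff_reflect reflect_P1 subset_iff)
qed

lemma is_glb_icv_reflect:
  assumes A: "A \<subseteq> P1" and "\<nu> \<in> P1"
  shows "is_glb icv_order \<nu> A \<longleftrightarrow> is_lub icx_order (reflect \<nu>) (reflect ` A)"
proof -
  have A': "reflect ` A \<subseteq> P1" using A reflect_P1 by auto
  show ?thesis
    unfolding is_glb_icv_iff[OF A] is_lub_icx_iff[OF A']
    using assms
    by (subst ball_P1_reflect[symmetric]) (auto simp: icv_le_iff_reflect reflect_P1 subset_iff)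
qed

definition icv_icx_bounded :: "real measure set \<Rightarrow> bool" where
  "icv_icx_bounded K \<longleftrightarrow> (\<exists>\<mu>l\<in>P1. \<exists>\<mu>u\<in>P1. \<forall>\<mu>\<in>K. \<mu>l \<le>icv \<mu> \<and> \<mu> \<le>icx \<mu>u)"

lemma icv_icx_bounded_subset: "icv_icx_bounded K \<Longrightarrow> A \<subseteq> K \<Longrightarrow> icv_icx_bounded A"
  unfolding icv_icx_bounded_def by (meson subsetD)

lemma icv_icx_bounded_reflect:
  assumes "K \<subseteq> P1" "icv_icx_bounded K"
  shows "icv_icx_bounded (reflect ` K)"
proof -
  obtain l u where lu: "l \<in> P1" "u \<in> P1" "\<forall>\<mu>\<in>K. l \<le>icv \<mu> \<and> \<mu> \<le>icx u"
    using assms(2) by (auto simp: icv_icx_bounded_def)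
  \<comment> \<open>Reflection exchanges the roles of the two bounds.\<close>
  have "reflect u \<le>icv reflect \<mu> \<and> reflect \<mu> \<le>icx reflect l" if "\<mu> \<in> K" for \<mu>
    using lu assms(1) that by (auto simp: icv_le_iff_reflect reflect_P1 reflect_reflect subset_iff)
  then show ?thesis
    unfolding icv_icx_bounded_def using lu(1,2) reflect_P1 by (metis imageE)
qed

lemma bounded_imp_icx_lub_glb:
  assumes A: "A \<subseteq> P1" "A \<noteq> {}" and bounded: "icv_icx_bounded A"
  shows "\<exists>\<nu>. is_lub icx_order \<nu> A" "\<exists>\<nu>. is_glb icx_order \<nu> A"
proof -
  obtain l u where lu: "l \<in> P1" "u \<in> P1" "\<forall>\<mu>\<in>A. l \<le>icv \<mu> \<and> \<mu> \<le>icx u"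
    using bounded by (auto simp: icv_icx_bounded_def)
  show "\<exists>\<nu>. is_lub icx_order \<nu> A"
    by (rule icx_lub_exists[OF A lu(2)]) (use lu(3) in auto)
  \<comment> \<open>The lower bound \<open>l\<close> is one for \<open>\<le>icv\<close> only, but
    that suffices to bound all means below by the mean of \<open>l\<close>.\<close>
  show "\<exists>\<nu>. is_glb icx_order \<nu> A"
    by (rule icx_glb_exists[OF A, of "\<integral>x. x \<partial>l"]) (use lu A(1) in \<open>auto intro: icv_le_mean\<close>)
qed

lemma bounded_imp_icv_lub_glb:
  assumes A: "A \<subseteq> P1" "A \<noteq> {}" and bounded: "icv_icx_bounded A"
  shows "\<exists>\<nu>. is_lub icv_order \<nu> A" "\<exists>\<nu>. is_glb icv_order \<nu> A"
proof -
  have A': "reflect ` A \<subseteq> P1" "reflect ` A \<noteq> {}" using A reflect_P1 by auto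
  note ex = bounded_imp_icx_lub_glb[OF A' icv_icx_bounded_reflect[OF A(1) bounded]]
  obtain \<nu> where \<nu>: "is_glb icx_order \<nu> (reflect ` A)" using ex(2) by auto
  then have "\<nu> \<in> P1" using is_glb_icx_iff[OF A'(1)] by simp
  with \<nu> have "is_lub icv_order (reflect \<nu>) A"
    by (simp add: is_lub_icv_reflect A(1) reflect_P1 reflect_reflect)
  then show "\<exists>\<nu>. is_lub icv_order \<nu> A" ..
  obtain \<nu> where \<nu>: "is_lub icx_order \<nu> (reflect ` A)" using ex(1) by auto
  then have "\<nu> \<in> P1" using is_lub_icx_iff[OF A'(1)] by simp
  with \<nu> have "is_glb icv_order (reflect \<nu>) A"
    by (simp add: is_glb_icv_reflect A(1) reflect_P1 reflect_reflect)
  then show "\<exists>\<nu>. is_glb icv_order \<nu> A" ..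
qed

section \<open>Means of the extremal bounds\<close>

lemma mean_icx_lub_le:
  assumes K: "K \<subseteq> P1" "K \<noteq> {}" and bounded: "icv_icx_bounded K"
    and lub: "is_lub icx_order \<nu> K" and r: "\<And>\<mu>. \<mu> \<in> K \<Longrightarrow> (\<integral>x. x \<partial>\<mu>) \<le> r"
  shows "(\<integral>x. x \<partial>\<nu>) \<le> r"
proof -
  obtain l u where lu: "l \<in> P1" "u \<in> P1" "\<And>\<mu>. \<mu> \<in> K \<Longrightarrow> l \<le>icv \<mu>" "\<And>\<mu>. \<mu> \<in> K \<Longrightarrow> \<mu> \<le>icx u"
    using bounded by (auto simp: icv_icx_bounded_def)
  \<comment> \<open>\<open>\<rho>\<close> is the least upper bound with a known integrated tail;
    \<open>\<nu> \<le>icx \<rho>\<close> carries the estimate over to \<open>\<nu>\<close>.\<close>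
  obtain \<rho> where \<rho>: "is_lub icx_order \<rho> K" "\<And>s. mu1_plus \<rho> s = (SUP \<mu>\<in>K. mu1_plus \<mu> s)"
    using icx_lub_exists[OF K lu(2,4)] by metis
  have P1: "\<nu> \<in> P1" "\<rho> \<in> P1" and "\<nu> \<le>icx \<rho>"
    using lub \<rho>(1) by (auto simp: is_lub_icx_iff[OF K(1)])
  \<comment> \<open>The common lower bound \<open>l\<close> makes the error
    \<open>- mu1_minus \<mu> s\<close> small uniformly over \<open>K\<close>; this is what permits s
    to tend to minus infinity after the supremum has been taken.\<close>
  have "(\<integral>x. x \<partial>\<nu>) \<le> r - mu1_minus l s" for s
  proof -
    have "(\<integral>x. x \<partial>\<nu>) \<le> s + mu1_plus \<nu> s" by (rule mean_le_mu1_plus[OF P1(1)])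
    also have "\<dots> \<le> s + mu1_plus \<rho> s" using \<open>\<nu> \<le>icx \<rho>\<close> by (simp add: icx_le_def)
    also have "mu1_plus \<rho> s \<le> r - s - mu1_minus l s"
      unfolding \<rho>(2)
    proof (rule cSUP_least[OF K(2)])
      fix \<mu> assume \<mu>: "\<mu> \<in> K"
      then have "mu1_plus \<mu> s = (\<integral>x. x \<partial>\<mu>) - s - mu1_minus \<mu> s" using K(1) by (auto intro: mu1_plus_eq)
      moreover have "mu1_minus l s \<le> mu1_minus \<mu> s" using lu(3)[OF \<mu>] by (simp add: icv_le_def)
      ultimately show "mu1_plus \<mu> s \<le> r - s - mu1_minus l s" using r[OF \<mu>] by simp
    qed
    finally show ?thesis by simp
  qed
  moreover have "((\<lambda>s. r - mu1_minus l s) \<longlongrightarrow> r - 0) at_bot"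
    by (intro tendsto_intros mu1_minus_tendsto_0 lu(1))
  ultimately have "(\<integral>x. x \<partial>\<nu>) \<le> r - 0"
    by (intro tendsto_lowerbound) auto
  then show ?thesis by simp
qed

lemma mean_icx_lub:
  assumes K: "K \<subseteq> P1" "K \<noteq> {}" and bounded: "icv_icx_bounded K"
    and lub: "is_lub icx_order \<nu> K"
  shows "ereal (\<integral>x. x \<partial>\<nu>) = (SUP \<mu>\<in>K. ereal (\<integral>x. x \<partial>\<mu>))"
proof (rule SUP_eqI[symmetric])
  show "ereal (\<integral>x. x \<partial>\<mu>) \<le> ereal (\<integral>x. x \<partial>\<nu>)" if "\<mu> \<in> K" for \<mu>
    using lub that K(1) by (auto simp: is_lub_icx_iff intro: icx_le_mean)
  fix y assume y: "\<And>\<mu>. \<mu> \<in> K \<Longrightarrow> ereal (\<integral>x. x \<partial>\<mu>) \<le> y"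
  show "ereal (\<integral>x. x \<partial>\<nu>) \<le> y"
  \<comment> \<open>The value \<infinity> is trivial, and -\<infinity> cannot bound the mean of a
    member of the nonempty \<open>K\<close>.\<close>
  proof (cases y)
    case (real r)
    with y mean_icx_lub_le[OF assms, of r] show ?thesis by auto
  qed (use y K(2) in auto)
qed

lemma mean_icv_glb:
  assumes K: "K \<subseteq> P1" "K \<noteq> {}" and bounded: "icv_icx_bounded K"
    and glb: "is_glb icv_order \<nu> K"
  shows "ereal (\<integral>x. x \<partial>\<nu>) = (INF \<mu>\<in>K. ereal (\<integral>x. x \<partial>\<mu>))"
proof -
  have \<nu>: "\<nu> \<in> P1" using glb is_glb_icv_iff[OF K(1)] by simp
  have K': "reflect ` K \<subseteq> P1" "reflect ` K \<noteq> {}" using K reflect_P1 by auto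
  have "is_lub icx_order (reflect \<nu>) (reflect ` K)"
    using glb is_glb_icv_reflect[OF K(1) \<nu>] by simp
  from mean_icx_lub[OF K' icv_icx_bounded_reflect[OF K(1) bounded] this]
  have "ereal (- (\<integral>x. x \<partial>\<nu>)) = (SUP \<mu>\<in>K. ereal (\<integral>x. x \<partial>reflect \<mu>))"
    by (simp add: mean_reflect \<nu> image_comp comp_def)
  also have "\<dots> = (SUP \<mu>\<in>K. - ereal (\<integral>x. x \<partial>\<mu>))"
    using K(1) by (intro SUP_cong) (auto simp: mean_reflect)
  also have "\<dots> = - (INF \<mu>\<in>K. ereal (\<integral>x. x \<partial>\<mu>))"
    by (rule ereal_SUP_uminus_eq)
  finally show ?thesis
    by (metis ereal_uminus_uminus uminus_ereal.simps(1))
qed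

section \<open>Uniform integrability\<close>

definition tail_moment :: "(real \<Rightarrow> real) \<Rightarrow> real measure set \<Rightarrow> real \<Rightarrow> ennreal" where
  "tail_moment \<psi> K s = (SUP \<mu>\<in>K. \<integral>\<^sup>+x. indicator (- {-s..s}) x * ennreal (\<psi> \<bar>x\<bar>) \<partial>\<mu>)"

lemma tail_moment_upper:
  "\<mu> \<in> K \<Longrightarrow> (\<integral>\<^sup>+x. indicator (- {-s..s}) x * ennreal (\<psi> \<bar>x\<bar>) \<partial>\<mu>) \<le> tail_moment \<psi> K s"
  unfolding tail_moment_def by (rule SUP_upper)

lemma tail_moment_least:
  "(\<And>\<mu>. \<mu> \<in> K \<Longrightarrow> (\<integral>\<^sup>+x. indicator (- {-s..s}) x * ennreal (\<psi> \<bar>x\<bar>) \<partial>\<mu>) \<le> b) \<Longrightarrow>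
    tail_moment \<psi> K s \<le> b"
  unfolding tail_moment_def by (rule SUP_least)

lemma uniformly_integrable_for_iff:
  "uniformly_integrable_for \<psi> K \<longleftrightarrow> (tail_moment \<psi> K \<longlongrightarrow> 0) at_top"
  by (simp add: uniformly_integrable_for_def tail_moment_def[abs_def])

lemma uniformly_integrable_forI:
  assumes "(g \<longlongrightarrow> 0) at_top" and "\<forall>\<^sub>F s in at_top. tail_moment \<psi> K s \<le> ennreal (g s)"
  shows "uniformly_integrable_for \<psi> K"
  unfolding uniformly_integrable_for_iff
proof (rule tendsto_sandwich[where f = "\<lambda>_. 0", OF _ assms(2)])
  show "((\<lambda>s. ennreal (g s)) \<longlongrightarrow> 0) at_top"
    using tendsto_ennrealI[OF assms(1)] by simp
qed auto

lemma uniformly_integrable_for_reflect: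
  assumes "K \<subseteq> P1" "uniformly_integrable_for (\<lambda>x. x) K"
  shows "uniformly_integrable_for (\<lambda>x. x) (reflect ` K)"
proof -
  have "(\<integral>\<^sup>+x. indicator (- {-s..s}) x * ennreal \<bar>x\<bar> \<partial>reflect \<mu>)
      = (\<integral>\<^sup>+x. indicator (- {-s..s}) x * ennreal \<bar>x\<bar> \<partial>\<mu>)" if "\<mu> \<in> K" for \<mu> s
  proof -
    have [measurable_cong]: "sets \<mu> = sets borel" using assms(1) that P1_sets by auto
    show ?thesis
      unfolding reflect_def
      by (subst nn_integral_distr) (simp_all, intro nn_integral_cong, simp split: split_indicator)
  qed
  then have "tail_moment (\<lambda>x. x) (reflect ` K) = tail_moment (\<lambda>x. x) K"
    by (simp add: tail_moment_def fun_eq_iff image_comp)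
  then show ?thesis
    using assms(2) by (simp add: uniformly_integrable_for_iff)
qed

text \<open>For s \<ge> 0 the function \<open>max (x - s) 0\<close> is at most
  \<open>\<bar>x\<bar>\<close> and vanishes on [-s, s], so the tail moments dominate the integrated
  tails and \<open>SUP_mu1_plus_attained\<close> applies.\<close>

lemma uniformly_integrable_imp_icx_bounded_above:
  assumes K: "K \<subseteq> P1" and ui: "uniformly_integrable_for (\<lambda>x. x) K"
  shows "\<exists>u\<in>P1. \<forall>\<mu>\<in>K. \<mu> \<le>icx u"
proof (cases "K = {}")
  case True
  then show ?thesis using return_P1 by auto
next
  case False
  have vanish: "\<exists>s. \<forall>\<mu>\<in>K. mu1_plus \<mu> s \<le> e" if e: "0 < e" for e
  proof -
    have "\<forall>\<^sub>F s in at_top. tail_moment (\<lambda>x. x) K s < ennreal e \<and> 0 \<le> s"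
      using ui e eventually_ge_at_top
      by (intro eventually_conj order_tendstoD) (auto simp: uniformly_integrable_for_iff)
    then obtain s where s: "tail_moment (\<lambda>x. x) K s < ennreal e" "0 \<le> s"
      by (auto simp: eventually_at_top_linorder)
    have "mu1_plus \<mu> s \<le> e" if \<mu>: "\<mu> \<in> K" for \<mu>
    proof -
      have "\<mu> \<in> P1" using \<mu> K by auto
      then have "ennreal (mu1_plus \<mu> s) = (\<integral>\<^sup>+x. ennreal (max (x - s) 0) \<partial>\<mu>)"
        unfolding mu1_plus_def
        by (intro nn_integral_eq_integral[symmetric] P1_integrable) auto
      also have "\<dots> \<le> (\<integral>\<^sup>+x. indicator (- {-s..s}) x * ennreal \<bar>x\<bar> \<partial>\<mu>)"
        using s(2)
        by (intro nn_integral_mono) (auto split: split_indicator intro!: ennreal_leI simp: ennreal_neg)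
      also have "\<dots> \<le> tail_moment (\<lambda>x. x) K s"
        by (rule tail_moment_upper[OF \<mu>])
      also have "\<dots> \<le> ennreal e" using s(1) by simp
      finally show ?thesis using e by (simp add: ennreal_le_iff)
    qed
    then show ?thesis by auto
  qed
  from SUP_mu1_plus_attained[OF K False vanish] show ?thesis by metis
qed

lemma uniformly_integrable_imp_bounded:
  assumes K: "K \<subseteq> P1" and ui: "uniformly_integrable_for (\<lambda>x. x) K"
  shows "icv_icx_bounded K"
proof -
  obtain u where u: "u \<in> P1" "\<forall>\<mu>\<in>K. \<mu> \<le>icx u"
    using uniformly_integrable_imp_icx_bounded_above[OF assms] by auto
  have K': "reflect ` K \<subseteq> P1" using K reflect_P1 by auto
  obtain v where v: "v \<in> P1" "\<forall>\<mu>\<in>reflect ` K. \<mu> \<le>icx v"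
    using uniformly_integrable_imp_icx_bounded_above[OF K' uniformly_integrable_for_reflect[OF assms]]
    by auto
  have "reflect v \<le>icv \<mu>" if "\<mu> \<in> K" for \<mu>
    using v that K by (auto simp: icv_le_iff_reflect reflect_P1 reflect_reflect subset_iff)
  with u reflect_P1[OF v(1)] show ?thesis
    unfolding icv_icx_bounded_def by blast
qed

lemma bounded_imp_uniformly_integrable:
  assumes K: "K \<subseteq> P1" and bounded: "icv_icx_bounded K"
  shows "uniformly_integrable_for (\<lambda>x. x) K"
proof -
  obtain l u where lu: "l \<in> P1" "u \<in> P1" "\<And>\<mu>. \<mu> \<in> K \<Longrightarrow> l \<le>icv \<mu>" "\<And>\<mu>. \<mu> \<in> K \<Longrightarrow> \<mu> \<le>icx u"
    using bounded by (auto simp: icv_icx_bounded_def)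
  define g where "g s = 2 * (mu1_plus u (s / 2) + mu1_plus (reflect l) (s / 2))" for s
  have half: "filterlim (\<lambda>s::real. s / 2) at_top at_top"
    by real_asymp
  have "(g \<longlongrightarrow> 2 * (0 + 0)) at_top"
    unfolding g_def
    by (intro tendsto_intros filterlim_compose[OF mu1_plus_tendsto_0 half] lu reflect_P1)
  then have g: "(g \<longlongrightarrow> 0) at_top" by simp
  have "tail_moment (\<lambda>x. x) K s \<le> ennreal (g s)" if s: "0 \<le> s" for s
  proof (rule tail_moment_least)
    fix \<mu> assume \<mu>: "\<mu> \<in> K"
    then have P1: "\<mu> \<in> P1" using K by auto
    \<comment> \<open>For s \<ge> 0 the integrand is
      \<open>2 * max (\<bar>x\<bar> - s / 2) 0\<close>, split by the sign of x so that each half is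
      an integrated tail.\<close>
    have int: "integrable \<mu> (\<lambda>x. 2 * (max (x - s / 2) 0 - min (x - - (s / 2)) 0))"
      by (intro Bochner_Integration.integrable_diff integrable_mult_right P1_integrable P1)
    have "(\<integral>\<^sup>+x. indicator (- {-s..s}) x * ennreal \<bar>x\<bar> \<partial>\<mu>)
        \<le> (\<integral>\<^sup>+x. ennreal (2 * (max (x - s / 2) 0 - min (x - - (s / 2)) 0)) \<partial>\<mu>)"
      using s by (intro nn_integral_mono) (auto split: split_indicator intro!: ennreal_leI)
    also have "\<dots> = ennreal (\<integral>x. 2 * (max (x - s / 2) 0 - min (x - - (s / 2)) 0) \<partial>\<mu>)"
      by (rule nn_integral_eq_integral[OF int]) auto
    also have "(\<integral>x. 2 * (max (x - s / 2) 0 - min (x - - (s / 2)) 0) \<partial>\<mu>)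
        = 2 * (mu1_plus \<mu> (s / 2) + mu1_plus (reflect \<mu>) (s / 2))"
      unfolding mu1_plus_reflect[OF P1] unfolding mu1_plus_def mu1_minus_def integral_mult_right_zero
        Bochner_Integration.integral_diff[OF P1_integrable(2,3)[OF P1]]
      by simp
    also have "ennreal \<dots> \<le> ennreal (g s)"
    proof -
      have "reflect \<mu> \<le>icx reflect l" "\<mu> \<le>icx u"
        using lu(3,4)[OF \<mu>] icv_le_iff_reflect[OF lu(1) P1] by auto
      then show ?thesis
        unfolding g_def icx_le_def by (intro ennreal_leI mult_left_mono add_mono) auto
    qed
    finally show "(\<integral>\<^sup>+x. indicator (- {-s..s}) x * ennreal \<bar>x\<bar> \<partial>\<mu>) \<le> ennreal (g s)" .
  qed
  then show ?thesis
    by (intro uniformly_integrable_forI[OF g] eventually_at_top_linorderI[of 0]) auto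
qed

section \<open>From a superlinear moment to uniform integrability\<close>

lemma measurable_comp_abs:
  fixes \<psi> :: "real \<Rightarrow> real"
  assumes "mono_on {0..} \<psi>"
  shows "(\<lambda>x. \<psi> \<bar>x\<bar>) \<in> borel_measurable borel"
proof -
  \<comment> \<open>\<open>\<psi>\<close> is arbitrary on the negative axis; extending it there by
    \<open>\<psi> 0\<close> yields a monotone, hence Borel, function.\<close>
  have "mono (\<lambda>x. \<psi> (max x 0))"
    using assms by (auto simp: mono_def mono_on_def)
  then have [measurable]: "(\<lambda>x. \<psi> (max x 0)) \<in> borel_measurable borel"
    by (rule borel_measurable_mono)
  have "(\<lambda>x. (\<lambda>x. \<psi> (max x 0)) \<bar>x\<bar>) \<in> borel_measurable borel"
    by (rule measurable_compose[of abs _ borel]) auto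
  then show ?thesis by simp
qed

lemma superlinear_imp_uniformly_integrable:
  assumes K: "K \<subseteq> P1" and "superlinear_moment_bound \<psi> K"
  shows "uniformly_integrable_for (\<lambda>x. x) K"
proof -
  have mono: "mono_on {0..} \<psi>" and nonneg: "\<And>s. 0 \<le> s \<Longrightarrow> 0 \<le> \<psi> s" and lim: "filterlim (\<lambda>s. \<psi> s / s) at_top at_top"
    and fin: "(SUP \<mu>\<in>K. \<integral>\<^sup>+x. ennreal (\<psi> \<bar>x\<bar>) \<partial>\<mu>) < \<infinity>"
    using assms by (auto simp: superlinear_moment_bound_def nondecreasing_nonneg_def)
  obtain B where B: "0 \<le> B" "(SUP \<mu>\<in>K. \<integral>\<^sup>+x. ennreal (\<psi> \<bar>x\<bar>) \<partial>\<mu>) = ennreal B"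
    using fin by (cases "SUP \<mu>\<in>K. \<integral>\<^sup>+x. ennreal (\<psi> \<bar>x\<bar>) \<partial>\<mu>") auto
  show ?thesis
    unfolding uniformly_integrable_for_iff
  proof (rule order_tendstoI)
    fix a :: ennreal assume a: "0 < a"
    obtain e where e: "0 < e" "ennreal e < a"
    proof -
      obtain b where "0 < b" "b < a" using dense[OF a] by auto
      then show thesis by (cases b) (auto intro: that)
    qed
    \<comment> \<open>Once \<open>\<psi> s \<ge> C * s\<close>, tail moments are at most
      \<open>B / C\<close>, which is at most \<open>e\<close>; the summand 1 keeps \<open>C\<close>
      positive when \<open>B = 0\<close>.\<close>
    define C where "C = (B + 1) / e"
    have C: "0 < C" using B e by (simp add: C_def)
    have "\<forall>\<^sub>F s in at_top. C \<le> \<psi> s / s"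
      using lim by (simp add: filterlim_at_top)
    then obtain s0 where s0: "\<And>s. s0 \<le> s \<Longrightarrow> C \<le> \<psi> s / s"
      by (auto simp: eventually_at_top_linorder)
    have "tail_moment (\<lambda>x. x) K s < a" if s: "max s0 0 \<le> s" for s
    proof -
      have "tail_moment (\<lambda>x. x) K s \<le> ennreal e"
      proof (rule tail_moment_least)
        fix \<mu> assume \<mu>: "\<mu> \<in> K"
        have [measurable_cong]: "sets \<mu> = sets borel" using K \<mu> P1_sets by auto
        have [measurable]: "(\<lambda>x. \<psi> \<bar>x\<bar>) \<in> borel_measurable \<mu>"
          using measurable_comp_abs[OF mono] by simp
        have "(\<integral>\<^sup>+x. indicator (- {-s..s}) x * ennreal \<bar>x\<bar> \<partial>\<mu>)
            \<le> (\<integral>\<^sup>+x. ennreal (1 / C) * ennreal (\<psi> \<bar>x\<bar>) \<partial>\<mu>)"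
        proof (rule nn_integral_mono)
          fix x
          show "indicator (- {-s..s}) x * ennreal \<bar>x\<bar> \<le> ennreal (1 / C) * ennreal (\<psi> \<bar>x\<bar>)"
          proof (cases "x \<in> {-s..s}")
            case False
            then have "s0 \<le> \<bar>x\<bar>" "0 < \<bar>x\<bar>" using s by auto
            with s0[of "\<bar>x\<bar>"] C have "\<bar>x\<bar> \<le> 1 / C * \<psi> \<bar>x\<bar>"
              by (simp add: field_simps)
            then show ?thesis
              using C nonneg[of "\<bar>x\<bar>"] by (auto simp: ennreal_mult[symmetric] ennreal_leI split: split_indicator)
          qed simp
        qed
        also have "\<dots> \<le> ennreal (1 / C) * ennreal B"
          unfolding B(2)[symmetric]
          by (subst nn_integral_cmult) (auto intro!: mult_left_mono SUP_upper \<mu>)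
        also have "\<dots> \<le> ennreal e"
          using B C e by (simp add: ennreal_mult[symmetric] C_def field_simps)
        finally show "(\<integral>\<^sup>+x. indicator (- {-s..s}) x * ennreal \<bar>x\<bar> \<partial>\<mu>) \<le> ennreal e" .
      qed
      also note e(2)
      finally show ?thesis .
    qed
    then show "\<forall>\<^sub>F s in at_top. tail_moment (\<lambda>x. x) K s < a"
      by (rule eventually_at_top_linorderI)
  qed simp
qed

section \<open>The de la Vallee-Poussin criterion\<close>

text \<open>A continuously differentiable substitute for the hinge \<open>max t 0\<close>, with
  slope 0 at the origin. In this form the bounds \<open>t - 1\<close> and \<open>max t 0\<close> are
  immediate, and for t \<ge> 0 only the term \<open>1 / (1 + t)\<close> is not affine.\<close>

definition smooth_ramp :: "real \<Rightarrow> real" where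
  "smooth_ramp t = max t 0 - 1 + 1 / (1 + max t 0)"

definition smooth_ramp' :: "real \<Rightarrow> real" where
  "smooth_ramp' t = 1 - 1 / (1 + max t 0)\<^sup>2"

lemma smooth_ramp_eq_0: "t \<le> 0 \<Longrightarrow> smooth_ramp t = 0" "t \<le> 0 \<Longrightarrow> smooth_ramp' t = 0"
  by (simp_all add: smooth_ramp_def smooth_ramp'_def max_def)

lemma smooth_ramp_pos: "0 \<le> t \<Longrightarrow> smooth_ramp t = t\<^sup>2 / (1 + t)"
  by (simp add: smooth_ramp_def field_simps power2_eq_square)

lemma smooth_ramp_nonneg: "0 \<le> smooth_ramp t"
  using smooth_ramp_eq_0[of t] smooth_ramp_pos[of t] by (cases "t \<le> 0") auto

lemma smooth_ramp_le: "smooth_ramp t \<le> max t 0"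
  by (simp add: smooth_ramp_def)

lemma smooth_ramp_ge: "t - 1 \<le> smooth_ramp t"
proof -
  have "0 \<le> 1 / (1 + max t 0)" by simp
  then show ?thesis unfolding smooth_ramp_def by linarith
qed

lemma smooth_ramp'_mono: "s \<le> t \<Longrightarrow> smooth_ramp' s \<le> smooth_ramp' t"
  unfolding smooth_ramp'_def
  by (intro diff_mono divide_left_mono power_mono mult_pos_pos zero_less_power) auto

lemma smooth_ramp'_nonneg: "0 \<le> smooth_ramp' t"
  using smooth_ramp'_mono[of "min t 0" t] smooth_ramp_eq_0(2)[of "min t 0"] by simp

lemma has_real_derivative_smooth_ramp:
  "(smooth_ramp has_real_derivative smooth_ramp' t) (at t)"
proof (rule linorder_cases[of t 0])
  assume t: "t < 0"
  have "((\<lambda>_. 0) has_real_derivative smooth_ramp' t) (at t)"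
    using t by (simp add: smooth_ramp_eq_0)
  then show ?thesis
    by (rule has_field_derivative_transform_within_open[of _ _ _ "{..<0}"])
       (use t in \<open>auto simp: smooth_ramp_eq_0\<close>)
next
  assume t: "0 < t"
  have "((\<lambda>t. t - 1 + 1 / (1 + t)) has_real_derivative smooth_ramp' t) (at t)"
    using t by (auto intro!: derivative_eq_intros simp: smooth_ramp'_def power2_eq_square)
  then show ?thesis
    by (rule has_field_derivative_transform_within_open[of _ _ _ "{0<..}"])
       (use t in \<open>auto simp: smooth_ramp_def\<close>)
next
  assume t: "t = 0"
  \<comment> \<open>At the kink of \<open>max\<close> the difference quotient is 0 on the left and
    \<open>h / (1 + h)\<close> on the right.\<close>
  have "((\<lambda>h. smooth_ramp h / h) \<longlongrightarrow> 0) (at 0)"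
  proof (rule Lim_null_comparison)
    show "\<forall>\<^sub>F h in at 0. norm (smooth_ramp h / h) \<le> \<bar>h\<bar>"
    proof (rule always_eventually, rule allI)
      fix h :: real
      show "norm (smooth_ramp h / h) \<le> \<bar>h\<bar>"
      proof (cases "h \<le> 0")
        case False
        then have "smooth_ramp h / h = h / (1 + h)"
          by (simp add: smooth_ramp_pos power2_eq_square)
        also have "\<dots> \<le> h" using False by (simp add: divide_le_eq distrib_left)
        finally show ?thesis using False smooth_ramp_nonneg[of h] by simp
      qed (simp add: smooth_ramp_eq_0)
    qed
    show "((\<lambda>h::real. \<bar>h\<bar>) \<longlongrightarrow> 0) (at 0)"
      by (rule tendsto_rabs_zero) (rule tendsto_ident_at)
  qed
  then show ?thesis
    by (simp add: t DERIV_def smooth_ramp_eq_0)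
qed

lemma continuous_on_smooth_ramp' [continuous_intros]:
  assumes "continuous_on S f"
  shows "continuous_on S (\<lambda>x. smooth_ramp' (f x))"
  unfolding smooth_ramp'_def
  by (intro continuous_intros assms) (simp add: add_nonneg_eq_0_iff)

lemma smooth_ramp_mono: "s \<le> t \<Longrightarrow> smooth_ramp s \<le> smooth_ramp t"
  by (rule DERIV_nonneg_imp_nondecreasing) 
     (use has_real_derivative_smooth_ramp smooth_ramp'_nonneg in blast)+

lemma convex_smooth_ramp: "convex_on UNIV smooth_ramp"
  by (rule convex_on_realI[where f' = smooth_ramp'])
     (auto simp: has_real_derivative_smooth_ramp smooth_ramp'_mono)

text \<open>The affine part cancels, which leaves strict convexity of the reciprocal on the positive
  axis.\<close>

lemma smooth_ramp_strictly_convex: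
  assumes "0 \<le> x" "0 \<le> y" "x \<noteq> y" "0 < t" "t < 1"
  shows "smooth_ramp ((1 - t) * x + t * y) < (1 - t) * smooth_ramp x + t * smooth_ramp y"
proof -
  define a b where "a = 1 + x" and "b = 1 + y"
  define z where "z = (1 - t) * a + t * b"
  have pos: "0 < a" "0 < b" using assms by (auto simp: a_def b_def)
  then have z: "0 < z" using assms by (auto simp: z_def intro!: add_pos_pos)
  \<comment> \<open>Clearing denominators turns the convexity gap of the reciprocal into a positive
    multiple of \<open>(a - b)\<^sup>2\<close>.\<close>
  have "((1 - t) / a + t / b - 1 / z) * (a * b * z) = ((1 - t) * b + t * a) * z - a * b"
    using pos z by (simp add: field_simps)
  also have "\<dots> = t * (1 - t) * (a - b)\<^sup>2"
    unfolding z_def by (simp add: algebra_simps power2_eq_square)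
  also have "\<dots> > 0" using assms by (auto simp: a_def b_def)
  finally have gap: "0 < (1 - t) / a + t / b - 1 / z"
    by (rule zero_less_mult_pos2) (use pos z in simp)
  have "0 \<le> (1 - t) * x + t * y" using assms by auto
  then have at_z: "smooth_ramp ((1 - t) * x + t * y) = (1 - t) * x + t * y - 1 + 1 / z"
    by (simp add: smooth_ramp_def z_def a_def b_def algebra_simps)
  have at_xy: "smooth_ramp x = x - 1 + 1 / a" "smooth_ramp y = y - 1 + 1 / b"
    using assms by (auto simp: smooth_ramp_def a_def b_def)
  show ?thesis
    unfolding at_z at_xy using gap by (simp add: algebra_simps)
qed

text \<open>Merges a bound that is small but constant in the summation index with one that is
  summable in it into a single bound with both virtues.\<close>

lemma ennreal_le_geometric_mean:
  assumes "c \<le> ennreal a" "c \<le> ennreal b" "0 \<le> a" "0 \<le> b"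
  shows "c \<le> ennreal (sqrt (a * b))"
  using assms(1)
proof (cases c)
  case (real r)
  then have "r \<le> a" "r \<le> b" using assms by (simp_all add: ennreal_le_iff)
  then have "r\<^sup>2 \<le> a * b"
    using real assms(3,4) unfolding power2_eq_square by (intro mult_mono)
  then show ?thesis
    using real by (simp add: ennreal_leI real_le_rsqrt)
qed (simp add: top_unique)

section \<open>Locally finite series of shifted ramps\<close>

definition ramp_series :: "(nat \<Rightarrow> real) \<Rightarrow> real \<Rightarrow> real" where
  "ramp_series s x = smooth_ramp x + (\<Sum>n. smooth_ramp (x - s n))"

definition ramp_series' :: "(nat \<Rightarrow> real) \<Rightarrow> real \<Rightarrow> real" where
  "ramp_series' s x = smooth_ramp' x + (\<Sum>n. smooth_ramp' (x - s n))"

context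
  fixes s :: "nat \<Rightarrow> real"
  assumes s_ge: "real n \<le> s n"
begin

text \<open>Since \<open>s n \<ge> n\<close>, the shifts with n \<ge> N do not contribute at any x
  \<le> N. Hence the series is a fixed finite sum on each half-line, and local properties carry over
  without uniform convergence.\<close>

lemma sums_locally_finite:
  fixes g :: "real \<Rightarrow> real"
  assumes "\<And>t. t \<le> 0 \<Longrightarrow> g t = 0" and "x \<le> real N"
  shows "(\<lambda>n. g (x - s n)) sums (\<Sum>n<N. g (x - s n))"
proof (rule sums_finite)
  fix n assume "n \<notin> {..<N}"
  then have "real N \<le> real n" by simp
  then have "x \<le> s n" using assms(2) s_ge[of n] by linarith
  then show "g (x - s n) = 0" by (simp add: assms(1))
qed simp

lemma summable_ramp: "summable (\<lambda>n. smooth_ramp (x - s n))"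
  using sums_locally_finite[of smooth_ramp x "nat \<lceil>x\<rceil>"]
  by (auto simp: smooth_ramp_eq_0 summable_def of_nat_ceiling)

lemma ramp_series_eq:
  assumes "x \<le> real N"
  shows "ramp_series s x = smooth_ramp x + (\<Sum>n<N. smooth_ramp (x - s n))"
    and "ramp_series' s x = smooth_ramp' x + (\<Sum>n<N. smooth_ramp' (x - s n))"
  using sums_locally_finite[of smooth_ramp x N] sums_locally_finite[of smooth_ramp' x N] assms
  by (auto simp: ramp_series_def ramp_series'_def smooth_ramp_eq_0 sums_iff)

lemma continuously_differentiable_ramp_series:
  "continuously_differentiable_nonneg (ramp_series s)"
proof -
  have deriv: "(ramp_series s has_real_derivative ramp_series' s x) (at x)" for x
  proof -
    obtain N where N: "x < real N" using reals_Archimedean2 by blast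
    have shift: "((\<lambda>x. smooth_ramp (x - s n)) has_real_derivative smooth_ramp' (x - s n)) (at x)" for n
      using has_real_derivative_smooth_ramp[of "x - s n"]
        DERIV_shift[of smooth_ramp "smooth_ramp' (x - s n)" x "- s n"] by simp
    have "((\<lambda>x. smooth_ramp x + (\<Sum>n<N. smooth_ramp (x - s n))) has_real_derivative ramp_series' s x) (at x)"
      unfolding ramp_series_eq(2)[OF less_imp_le[OF N]]
      by (intro DERIV_add DERIV_sum has_real_derivative_smooth_ramp shift)
    then show ?thesis
    proof (rule has_field_derivative_transform_within_open[of _ _ _ "{..<real N}"])
      fix y assume "y \<in> {..<real N}"
      then show "smooth_ramp y + (\<Sum>n<N. smooth_ramp (y - s n)) = ramp_series s y"
        by (intro ramp_series_eq(1)[symmetric]) simp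
    qed (use N in simp_all)
  qed
  have "isCont (ramp_series' s) x" for x
  proof -
    obtain N where N: "x < real N" using reals_Archimedean2 by blast
    have "continuous_on {..<real N} (\<lambda>x. smooth_ramp' x + (\<Sum>n<N. smooth_ramp' (x - s n)))"
      by (intro continuous_intros)
    also have "?this \<longleftrightarrow> continuous_on {..<real N} (ramp_series' s)"
      by (intro continuous_on_cong refl) (simp add: ramp_series_eq(2)[of _ N])
    finally show ?thesis
      using N by (simp add: continuous_on_eq_continuous_at)
  qed
  then have "continuous_on {0..} (ramp_series' s)"
    by (intro continuous_at_imp_continuous_on ballI)
  with has_field_derivative_at_within[OF deriv] show ?thesis
    unfolding continuously_differentiable_nonneg_def
    by (intro exI[of _ "ramp_series' s"]) simp
qed

lemma ramp_series_nonneg: "0 \<le> ramp_series s x"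
  unfolding ramp_series_def
  by (intro add_nonneg_nonneg suminf_nonneg summable_ramp smooth_ramp_nonneg)

lemma ramp_series_mono: "x \<le> y \<Longrightarrow> ramp_series s x \<le> ramp_series s y"
  unfolding ramp_series_def
  by (intro add_mono suminf_le summable_ramp smooth_ramp_mono) auto

lemma ramp_series_0: "ramp_series s 0 = 0"
  using ramp_series_eq(1)[of 0 0] by (simp add: smooth_ramp_eq_0)

text \<open>The shifted ramps are merely convex, being 0 before their shift; strictness on all of
  \<open>{0..}\<close> comes from the unshifted first summand.\<close>

lemma ramp_series_strictly_convex: "strictly_convex_on {0..} (ramp_series s)"
  unfolding strictly_convex_on_def
proof (intro conjI ballI allI impI)
  fix x y t :: real
  assume *: "x \<in> {0..}" "y \<in> {0..}" "x \<noteq> y" "0 < t" "t < 1"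
  have conv: "smooth_ramp ((1 - t) * x + t * y - s n)
      \<le> (1 - t) * smooth_ramp (x - s n) + t * smooth_ramp (y - s n)" for n
  proof -
    have "smooth_ramp ((1 - t) *\<^sub>R (x - s n) + t *\<^sub>R (y - s n))
        \<le> (1 - t) * smooth_ramp (x - s n) + t * smooth_ramp (y - s n)"
      using * by (intro convex_onD[OF convex_smooth_ramp]) auto
    also have "(1 - t) *\<^sub>R (x - s n) + t *\<^sub>R (y - s n) = (1 - t) * x + t * y - s n"
      by (simp add: algebra_simps)
    finally show ?thesis .
  qed
  have "(\<Sum>n. smooth_ramp ((1 - t) * x + t * y - s n))
      \<le> (\<Sum>n. (1 - t) * smooth_ramp (x - s n) + t * smooth_ramp (y - s n))"
    by (intro suminf_le conv summable_ramp summable_add summable_mult)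
  also have "\<dots> = (1 - t) * (\<Sum>n. smooth_ramp (x - s n)) + t * (\<Sum>n. smooth_ramp (y - s n))"
    by (simp add: suminf_add[symmetric] suminf_mult summable_mult summable_ramp)
  finally show "ramp_series s ((1 - t) * x + t * y) < (1 - t) * ramp_series s x + t * ramp_series s y"
    using smooth_ramp_strictly_convex[of x y t] * unfolding ramp_series_def
    by (simp add: algebra_simps)
qed simp

lemma ramp_series_superlinear: "filterlim (\<lambda>x. ramp_series s x / x) at_top at_top"
  unfolding filterlim_at_top
proof
  fix Z :: real
  \<comment> \<open>The first N ramps together exceed \<open>N * x - C\<close>. With N - 1 \<ge> Z,
    the one spare unit of slope absorbs \<open>C\<close> as soon as x \<ge> C.\<close>
  define N where "N = Suc (nat \<lceil>Z\<rceil>)"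
  have N: "Z \<le> real N - 1" unfolding N_def by (simp add: of_nat_ceiling)
  define C where "C = (\<Sum>n<N. s n + 1)"
  have "Z \<le> ramp_series s x / x" if x: "max C 1 \<le> x" for x
  proof -
    have "Z * x \<le> (real N - 1) * x" using N x by (intro mult_right_mono) auto
    also have "\<dots> \<le> real N * x - C" using x by (simp add: algebra_simps)
    also have "\<dots> = (\<Sum>n<N. x - s n - 1)"
      by (simp add: C_def sum_subtractf sum.distrib)
    also have "\<dots> \<le> (\<Sum>n<N. smooth_ramp (x - s n))"
      by (intro sum_mono smooth_ramp_ge)
    also have "\<dots> \<le> (\<Sum>n. smooth_ramp (x - s n))"
      by (intro sum_le_suminf summable_ramp) (auto simp: smooth_ramp_nonneg)
    also have "\<dots> \<le> ramp_series s x"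
      by (simp add: ramp_series_def smooth_ramp_nonneg)
    finally show ?thesis using x by (simp add: le_divide_eq)
  qed
  then show "\<forall>\<^sub>F x in at_top. Z \<le> ramp_series s x / x"
    by (rule eventually_at_top_linorderI)
qed

text \<open>The \<open>n\<close>-th summand lives on the complement of \<open>{-max r (s n)..max r (s n)}\<close>; its contribution
  is at most \<open>min t (1/4)\<^sup>n \<le> sqrt t * (1/2)\<^sup>n\<close>.\<close>

lemma tail_moment_ramp_series_le:
  assumes K: "K \<subseteq> P1"
    and tail: "\<And>n. tail_moment (\<lambda>x. x) K (s n) \<le> ennreal ((1/4) ^ n)"
    and r: "0 \<le> r" and t: "0 \<le> t" "tail_moment (\<lambda>x. x) K r = ennreal t"
  shows "tail_moment (ramp_series s) K r \<le> ennreal (t + 2 * sqrt t)"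
proof (rule tail_moment_least)
  fix \<mu> assume \<mu>: "\<mu> \<in> K"
  have [measurable_cong]: "sets \<mu> = sets borel" using K \<mu> P1_sets by auto
  have s_nonneg: "0 \<le> s n" for n using s_ge[of n] by simp
  have half: "(\<integral>\<^sup>+x. indicator (- {-max r (s n)..max r (s n)}) x * ennreal \<bar>x\<bar> \<partial>\<mu>)
      \<le> ennreal (sqrt t * (1/2) ^ n)" (is "?I \<le> _") for n
  proof -
    have "?I \<le> (\<integral>\<^sup>+x. indicator (- {-r..r}) x * ennreal \<bar>x\<bar> \<partial>\<mu>)"
      by (intro nn_integral_mono) (auto split: split_indicator)
    also have "\<dots> \<le> ennreal t" using tail_moment_upper[OF \<mu>, of r "\<lambda>x. x"] t(2) by simp
    finally have le_t: "?I \<le> ennreal t" .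
    have "?I \<le> (\<integral>\<^sup>+x. indicator (- {-s n..s n}) x * ennreal \<bar>x\<bar> \<partial>\<mu>)"
      by (intro nn_integral_mono) (auto split: split_indicator)
    also have "\<dots> \<le> ennreal ((1/4) ^ n)" using tail_moment_upper[OF \<mu>, of "s n" "\<lambda>x. x"] tail[of n] by simp
    finally have le_4: "?I \<le> ennreal ((1/4) ^ n)" .
    have "sqrt (t * (1/4) ^ n) = sqrt t * (1/2) ^ n"
      by (simp add: real_sqrt_mult real_sqrt_power real_sqrt_divide power_divide)
    then show ?thesis
      using ennreal_le_geometric_mean[OF le_t le_4 t(1)] by simp
  qed
  have "(\<integral>\<^sup>+x. indicator (- {-r..r}) x * ennreal (ramp_series s \<bar>x\<bar>) \<partial>\<mu>)
      \<le> (\<integral>\<^sup>+x. indicator (- {-r..r}) x * ennreal \<bar>x\<bar>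
          + (\<Sum>n. indicator (- {-max r (s n)..max r (s n)}) x * ennreal \<bar>x\<bar>) \<partial>\<mu>)"
  proof (rule nn_integral_mono)
    fix x
    show "indicator (- {-r..r}) x * ennreal (ramp_series s \<bar>x\<bar>)
      \<le> indicator (- {-r..r}) x * ennreal \<bar>x\<bar>
          + (\<Sum>n. indicator (- {-max r (s n)..max r (s n)}) x * ennreal \<bar>x\<bar>)"
    proof (cases "x \<in> {-r..r}")
      case False
      \<comment> \<open>The ramp vanishes for \<open>\<bar>x\<bar> \<le> s n\<close> and is
        otherwise at most \<open>\<bar>x\<bar>\<close>, because \<open>s n \<ge> 0\<close>; outside
        [-r, r] this is the region cut off at \<open>max r (s n)\<close>.\<close>
      have "ennreal (smooth_ramp (\<bar>x\<bar> - s n)) \<le> indicator (- {-max r (s n)..max r (s n)}) x * ennreal \<bar>x\<bar>" for n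
        using smooth_ramp_le[of "\<bar>x\<bar> - s n"] smooth_ramp_eq_0[of "\<bar>x\<bar> - s n"] False s_nonneg[of n]
        by (cases "\<bar>x\<bar> \<le> s n") (auto split: split_indicator intro!: ennreal_leI)
      then have "(\<Sum>n. ennreal (smooth_ramp (\<bar>x\<bar> - s n)))
          \<le> (\<Sum>n. indicator (- {-max r (s n)..max r (s n)}) x * ennreal \<bar>x\<bar>)"
        by (intro suminf_le) auto
      then have "ennreal (smooth_ramp \<bar>x\<bar>) + ennreal (\<Sum>n. smooth_ramp (\<bar>x\<bar> - s n))
          \<le> ennreal \<bar>x\<bar> + (\<Sum>n. indicator (- {-max r (s n)..max r (s n)}) x * ennreal \<bar>x\<bar>)"
        using smooth_ramp_le[of "\<bar>x\<bar>"]
        by (intro add_mono ennreal_leI) (auto simp: suminf_ennreal2 summable_ramp smooth_ramp_nonneg)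
      also have "ennreal (smooth_ramp \<bar>x\<bar>) + ennreal (\<Sum>n. smooth_ramp (\<bar>x\<bar> - s n)) = ennreal (ramp_series s \<bar>x\<bar>)"
        unfolding ramp_series_def
        by (intro ennreal_plus[symmetric] smooth_ramp_nonneg suminf_nonneg summable_ramp)
      finally show ?thesis using False by simp
    qed simp
  qed
  also have "\<dots> = (\<integral>\<^sup>+x. indicator (- {-r..r}) x * ennreal \<bar>x\<bar> \<partial>\<mu>)
      + (\<Sum>n. \<integral>\<^sup>+x. indicator (- {-max r (s n)..max r (s n)}) x * ennreal \<bar>x\<bar> \<partial>\<mu>)"
    by (subst nn_integral_add, measurable, subst nn_integral_suminf) auto
  also have "\<dots> \<le> ennreal t + (\<Sum>n. ennreal (sqrt t * (1/2) ^ n))"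
    using tail_moment_upper[OF \<mu>, of r "\<lambda>x. x"] t(2)
    by (intro add_mono suminf_le half) auto
  also have "(\<Sum>n. ennreal (sqrt t * (1/2) ^ n)) = ennreal (2 * sqrt t)"
  proof -
    have sums: "(\<lambda>n. sqrt t * (1/2) ^ n) sums (sqrt t * 2)"
      using geometric_sums[of "1/2::real"] by (intro sums_mult) auto
    then have "(\<Sum>n. ennreal (sqrt t * (1/2) ^ n)) = ennreal (\<Sum>n. sqrt t * (1/2) ^ n)"
      using t(1) by (intro suminf_ennreal2) (auto simp: sums_iff)
    with sums show ?thesis by (simp add: sums_iff mult.commute)
  qed
  also have "ennreal t + ennreal (2 * sqrt t) = ennreal (t + 2 * sqrt t)"
    using t(1) by (simp add: ennreal_plus)
  finally show "(\<integral>\<^sup>+x. indicator (- {-r..r}) x * ennreal (ramp_series s \<bar>x\<bar>) \<partial>\<mu>)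
      \<le> ennreal (t + 2 * sqrt t)" .
qed

end

section \<open>Finite moments and the choice of the shifts\<close>

lemma uniformly_integrable_imp_moment_bound:
  assumes K: "K \<subseteq> P1" and ui: "uniformly_integrable_for \<psi> K" and mono: "mono_on {0..} \<psi>"
  shows "(SUP \<mu>\<in>K. \<integral>\<^sup>+x. ennreal (\<psi> \<bar>x\<bar>) \<partial>\<mu>) < \<infinity>"
proof -
  have "\<forall>\<^sub>F r in at_top. tail_moment \<psi> K r < 1 \<and> 0 \<le> r"
    using ui eventually_ge_at_top
    by (intro eventually_conj order_tendstoD) (auto simp: uniformly_integrable_for_iff)
  then obtain r where r: "tail_moment \<psi> K r < 1" "0 \<le> r"
    by (auto simp: eventually_at_top_linorder)
  have "(SUP \<mu>\<in>K. \<integral>\<^sup>+x. ennreal (\<psi> \<bar>x\<bar>) \<partial>\<mu>) \<le> ennreal (\<psi> r) + 1"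
  proof (rule SUP_least)
    fix \<mu> assume \<mu>: "\<mu> \<in> K"
    then interpret prob_space \<mu> using K P1_prob_space by auto
    have [measurable_cong]: "sets \<mu> = sets borel" using K \<mu> P1_sets by auto
    have [measurable]: "(\<lambda>x. \<psi> \<bar>x\<bar>) \<in> borel_measurable \<mu>"
      using measurable_comp_abs[OF mono] by simp
    \<comment> \<open>On [-r, r] monotonicity bounds \<open>\<psi> \<bar>x\<bar>\<close> by
      \<open>\<psi> r\<close>, integrated against total mass 1; the rest is a tail moment below
      1.\<close>
    have "(\<integral>\<^sup>+x. ennreal (\<psi> \<bar>x\<bar>) \<partial>\<mu>)
        \<le> (\<integral>\<^sup>+x. ennreal (\<psi> r) + indicator (- {-r..r}) x * ennreal (\<psi> \<bar>x\<bar>) \<partial>\<mu>)"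
      using mono r(2)
      by (intro nn_integral_mono) (auto split: split_indicator intro!: ennreal_leI simp: mono_on_def)
    also have "\<dots> = ennreal (\<psi> r) + (\<integral>\<^sup>+x. indicator (- {-r..r}) x * ennreal (\<psi> \<bar>x\<bar>) \<partial>\<mu>)"
      by (subst nn_integral_add) (auto simp: emeasure_space_1)
    also have "\<dots> \<le> ennreal (\<psi> r) + 1"
      using tail_moment_upper[OF \<mu>, of r \<psi>] r(1) by (intro add_mono) auto
    finally show "(\<integral>\<^sup>+x. ennreal (\<psi> \<bar>x\<bar>) \<partial>\<mu>) \<le> ennreal (\<psi> r) + 1" .
  qed
  also have "\<dots> < \<infinity>" by (simp add: ennreal_add_less_top)
  finally show ?thesis .
qed

lemma de_la_Vallee_Poussin:
  assumes K: "K \<subseteq> P1" and ui: "uniformly_integrable_for (\<lambda>x. x) K"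
  shows "\<exists>\<psi>. superlinear_moment_bound \<psi> K \<and> continuously_differentiable_nonneg \<psi> \<and>
    strictly_convex_on {0..} \<psi> \<and> uniformly_integrable_for \<psi> K"
proof -
  let ?T = "tail_moment (\<lambda>x. x) K"
  have lim: "(?T \<longlongrightarrow> 0) at_top" using ui by (simp add: uniformly_integrable_for_iff)
  \<comment> \<open>The shift is at least n for local finiteness. The rate \<open>(1/4) ^ n\<close>
    leaves the summable \<open>(1/2) ^ n\<close> after the square root of the geometric
    mean.\<close>
  have "\<exists>r. real n \<le> r \<and> ?T r \<le> ennreal ((1/4) ^ n)" for n
  proof -
    have "\<forall>\<^sub>F r in at_top. ?T r < ennreal ((1/4) ^ n) \<and> real n \<le> r"
      by (intro eventually_conj order_tendstoD[OF lim] eventually_ge_at_top) auto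
    then show ?thesis by (auto simp: eventually_at_top_linorder dest!: spec less_imp_le)
  qed
  then obtain s where s: "\<And>n. real n \<le> s n" "\<And>n. ?T (s n) \<le> ennreal ((1/4) ^ n)"
    by metis
  have ui_series: "uniformly_integrable_for (ramp_series s) K"
  proof (rule uniformly_integrable_forI)
    have "((\<lambda>r. enn2real (?T r)) \<longlongrightarrow> 0) at_top"
      by (rule tendsto_enn2real) (use lim in simp_all)
    then have "((\<lambda>r. enn2real (?T r) + 2 * sqrt (enn2real (?T r))) \<longlongrightarrow> 0 + 2 * sqrt 0) at_top"
      by (intro tendsto_add tendsto_mult tendsto_const tendsto_real_sqrt)
    then show "((\<lambda>r. enn2real (?T r) + 2 * sqrt (enn2real (?T r))) \<longlongrightarrow> 0) at_top" by simp
    \<comment> \<open>\<open>enn2real\<close> sends an infinite tail moment to 0, so the bound is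
      claimed only where \<open>?T r\<close> is known to be finite.\<close>
    have "\<forall>\<^sub>F r in at_top. ?T r < 1 \<and> 0 \<le> r"
      by (intro eventually_conj order_tendstoD[OF lim] eventually_ge_at_top) auto
    then show "\<forall>\<^sub>F r in at_top. tail_moment (ramp_series s) K r
        \<le> ennreal (enn2real (?T r) + 2 * sqrt (enn2real (?T r)))"
    proof eventually_elim
      case (elim r)
      then have "?T r < \<infinity>" using less_trans[of "?T r" 1 \<infinity>] by auto
      then have "?T r = ennreal (enn2real (?T r))" by simp
      then show ?case
        using elim by (intro tail_moment_ramp_series_le[OF s(1) K s(2)]) auto
    qed
  qed
  have mono: "mono_on {0..} (ramp_series s)"
    by (auto simp: mono_on_def intro: ramp_series_mono[OF s(1)])
  have "superlinear_moment_bound (ramp_series s) K"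
    unfolding superlinear_moment_bound_def nondecreasing_nonneg_def
    using mono ramp_series_nonneg[OF s(1)] ramp_series_0[OF s(1)] ramp_series_superlinear[OF s(1)]
      uniformly_integrable_imp_moment_bound[OF K ui_series mono]
    by auto
  with ui_series continuously_differentiable_ramp_series[OF s(1)]
    ramp_series_strictly_convex[OF s(1)] show ?thesis by blast
qed

section \<open>Assembly of the equivalences and their supplements\<close>

theorem lemma3p11:
  fixes K :: "real measure set"
  assumes "K \<subseteq> P1"
  shows
    "(uniformly_integrable_for (\<lambda>s. s) K \<longleftrightarrow>
        (\<exists>\<mu>l\<in>P1. \<exists>\<mu>u\<in>P1. \<forall>\<mu>\<in>K. \<mu>l \<le>icv \<mu> \<and> \<mu> \<le>icx \<mu>u)) \<and>
     (uniformly_integrable_for (\<lambda>s. s) K \<longleftrightarrow>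
        (\<forall>A. A \<subseteq> K \<and> A \<noteq> {} \<longrightarrow>
           (\<exists>\<mu>. is_lub icv_order \<mu> A) \<and> (\<exists>\<mu>. is_glb icv_order \<mu> A) \<and>
           (\<exists>\<mu>. is_lub icx_order \<mu> A) \<and> (\<exists>\<mu>. is_glb icx_order \<mu> A))) \<and>
     (uniformly_integrable_for (\<lambda>s. s) K \<longleftrightarrow> (\<exists>\<psi>. superlinear_moment_bound \<psi> K)) \<and>
     (uniformly_integrable_for (\<lambda>s. s) K \<longrightarrow>
        (K \<noteq> {} \<longrightarrow>
           (\<forall>\<mu>l. is_glb icv_order \<mu>l K \<longrightarrow>
              ereal (\<integral>x. x \<partial>\<mu>l) = (INF \<mu>\<in>K. ereal (\<integral>x. x \<partial>\<mu>))) \<and>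
           (\<forall>\<mu>u. is_lub icx_order \<mu>u K \<longrightarrow>
              ereal (\<integral>x. x \<partial>\<mu>u) = (SUP \<mu>\<in>K. ereal (\<integral>x. x \<partial>\<mu>)))) \<and>
        (\<exists>\<psi>. superlinear_moment_bound \<psi> K \<and> continuously_differentiable_nonneg \<psi> \<and>
             strictly_convex_on {0..} \<psi> \<and> uniformly_integrable_for \<psi> K))"
    (is "(?ui \<longleftrightarrow> ?bounded) \<and> (?ui \<longleftrightarrow> ?lattice) \<and> (?ui \<longleftrightarrow> ?moment) \<and> (?ui \<longrightarrow> ?means \<and> ?smooth)")
proof -
  have bounded_iff: "?bounded \<longleftrightarrow> icv_icx_bounded K"
    by (simp add: icv_icx_bounded_def)
  have ui_iff: "?ui \<longleftrightarrow> icv_icx_bounded K"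
    using uniformly_integrable_imp_bounded[OF assms] bounded_imp_uniformly_integrable[OF assms] by blast
  have lattice: ?lattice if "icv_icx_bounded K"
  proof (intro allI impI, elim conjE)
    fix A assume A: "A \<subseteq> K" "A \<noteq> {}"
    then have "A \<subseteq> P1" "icv_icx_bounded A"
      using assms icv_icx_bounded_subset[OF that] by auto
    with A(2) show "(\<exists>\<mu>. is_lub icv_order \<mu> A) \<and> (\<exists>\<mu>. is_glb icv_order \<mu> A) \<and>
           (\<exists>\<mu>. is_lub icx_order \<mu> A) \<and> (\<exists>\<mu>. is_glb icx_order \<mu> A)"
      by (intro conjI bounded_imp_icv_lub_glb bounded_imp_icx_lub_glb)
  qed
  have bounded: ?bounded if ?lattice
  proof (cases "K = {}")
    case True
    then show ?thesis using return_P1 by blast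
  next
    \<comment> \<open>The lattice property applied to \<open>A = K\<close> itself supplies both
      bounding measures.\<close>
    case False
    with that obtain l u where "is_glb icv_order l K" "is_lub icx_order u K" by blast
    then show ?thesis
      unfolding is_glb_icv_iff[OF assms] is_lub_icx_iff[OF assms] by blast
  qed
  have smooth: ?smooth if ?ui
    by (rule de_la_Vallee_Poussin[OF assms that])
  have means: ?means if "icv_icx_bounded K"
    using mean_icv_glb[OF assms _ that] mean_icx_lub[OF assms _ that] by blast
  show ?thesis
    using bounded_iff ui_iff lattice bounded smooth means superlinear_imp_uniformly_integrable[OF assms]
    by blast
qed

end
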